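(* Let $\alpha\in(\frac14,\frac13]$ (so $N=\lfloor 1/\alpha\rfloor=3$), let $\mathbf X$ be an $\alpha$-Hölder planarly branched rough path over the alphabet $A=\{1,\dots,d\}$ above $X=(X^1,\dots,X^d):[0,T]\to\mathbb R^d$, let $\hat{\mathbf X}$ be a bracket extension of $\mathbf X$, above $\hat X=(X^1,\dots,X^d,(\hat X^{(ij)})_{1\le i,j\le d})$, and let $F:\mathbb R^d\to\mathbb R^n$ be a smooth function. For $i,j,k=1,\dots,d$ define $\tilde X^{(ijk)}:[0,T]\to\mathbb R$ (with a given initial value) by $$\tilde X^{(ijk)}_t-\tilde X^{(ijk)}_s:=\big\langle\hat{\mathbf X}_{s,t},\ \bullet_k\bullet_j\bullet_i-[\bullet_k\bullet_j]_i-[\bullet_k]_{(ij)}\big\rangle,\qquad s,t\in[0,T].$$ Then for all $s,t\in[0,T]$, $$F(X_t)-F(X_s)=\sum_{i=1}^d\int_s^t\partial_iF(X_r)\,dX^i_r+\sum_{i,j=1}^d\int_s^t\partial_i\partial_jF(X_r)\,d\hat X^{(ij)}_r+\sum_{i,j,k=1}^d\int_s^t\partial_i\partial_j\partial_kF(X_r)\,d\tilde X^{(ijk)}_r .$$ Here the first two families of integrals are rough integrals, the integrand $\partial_iF(X)$ being lifted to the $\mathbf X$-controlled planarly branched rough path $\partial_iF(\mathbf X)$ and the integrand $\partial_i\partial_jF(X)$ to $\partial_i\partial_jF(\mathbf X)$ regarded as an $\hat{\mathbf X}$-controlled planarly branched rough path, where for smooth $G:\mathbb R^d\to\mathbb R^n$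 the lift $G(\mathbf X)$ is defined by $\langle\mathbf 1,G(\mathbf X)_t\rangle=G(X_t)$, $\langle\bullet_k,G(\mathbf X)_t\rangle=\partial_kG(X_t)$, $\langle\bullet_k\bullet_l,G(\mathbf X)_t\rangle=\partial_k\partial_lG(X_t)$, $\langle[\bullet_l]_k,G(\mathbf X)_t\rangle=0$ for $k,l\in A$; the integrals against $\tilde X^{(ijk)}$ are Young integrals.
   Context: Forests. For a finite set $B$, $\mathcal F_B$ is the set of $B$-decorated planar rooted forests, i.e. finite ordered (possibly empty) sequences of planar rooted trees with vertices decorated by $B$; concatenation is written as juxtaposition, $\mathbf 1$ is the empty forest, $|\tau|$ is the number of vertices, and $\mathcal F_B^{\le m}=\{\tau\in\mathcal F_B: |\tau|\le m\}$. For $\tau\in\mathcal F_B$ and $b\in B$, $[\tau]_b$ is the tree obtained by joining the roots of the trees of $\tau$ (in the same left-to-right order) to a new root decorated by $b$; $\bullet_b=[\mathbf 1]_b$. Thus $[\bullet_j]_i$ is the ladder with root $i$ and leaf $j$, and $[\bullet_k\bullet_j]_i$ is the cherry with root $i$, left leaf $k$, right leaf $j$. Munthe-Kaas–Wright (MKW) Hopf algebra over $B$: the vector space $\mathbb R\mathcal F_B$ with the shuffle product ⧢ (forests viewed as words whose letters are trees) and the coproduct $\Delta$ given recursively by $\Delta(\mathbf 1)=\mathbf 1\otimes\mathbf 1$ and $\Delta(\omega[\tau]_b)=\omega[\tau]_b\otimes\mathbf 1+\Delta(\omega)\cdot(\mathrm{id}\otimes[\,\cdot\,]_b)\Delta(\tau)$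 for $\omega,\tau\in\mathcal F_B$, where $\cdot$ shuffles left tensor factors and concatenates right tensor factors (left admissible cuts). E.g. $\Delta(\bullet_j\bullet_i)=\bullet_j\bullet_i\otimes\mathbf 1+\bullet_j\otimes\bullet_i+\mathbf 1\otimes\bullet_j\bullet_i$ and $\Delta([\bullet_j]_i)=[\bullet_j]_i\otimes\mathbf 1+\bullet_j\otimes\bullet_i+\mathbf 1\otimes[\bullet_j]_i$. The pairing is $\langle\tau,\tau'\rangle=\delta_{\tau,\tau'}$ on forests and $\star$ is the dual product: $\langle x\star y,\tau\rangle=\langle x\otimes y,\Delta\tau\rangle$. Everything is truncated at $\mathbb R\mathcal F_B^{\le N}$. Planarly branched rough path. Let $\alpha\in(0,1]$, $N=\lfloor1/\alpha\rfloor$. An $\alpha$-Hölder planarly branched rough path over $B$ is a map $\mathbf X:[0,T]^2\to\mathbb R\mathcal F_B^{\le N}$ with $\langle\mathbf X_{s,t},\mathbf 1\rangle=1$ such that (1) $\mathbf X_{s,u}\star\mathbf X_{u,t}=\mathbf X_{s,t}$ in the algebra truncated at $N$; (2) $\langle\mathbf X_{s,t},\sigma ⧢ \tau\rangle=\langle\mathbf X_{s,t},\sigma\rangle\langle\mathbf X_{s,t},\tau\rangle$ whenever $|\sigma|+|\tau|\le N$; (3) $\sup_{s\ne t}|\langle\mathbf X_{s,t},\tau\rangle|/|t-s|^{|\tau|\alpha}<\infty$ for all $\tau\in\mathcal F_B^{\le N}$. It is above a path $(X^b)_{b\in B}$ if $\langle\mathbf X_{s,t},\bullet_b\rangle=X^b_t-X^b_s$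 for all $b\in B$. Controlled path. A map $\mathbf Y:[0,T]\to(\mathbb R\mathcal F_B^{\le N-1})^n$ (so $\langle\tau,\mathbf Y_t\rangle\in\mathbb R^n$) is an $\mathbf X$-controlled planarly branched rough path above $Y=\langle\mathbf 1,\mathbf Y\rangle$ if $|\langle\tau,\mathbf Y_t\rangle-\langle\mathbf X_{s,t}\star\tau,\mathbf Y_s\rangle|=O(|t-s|^{(N-|\tau|)\alpha})$ for all $\tau\in\mathcal F_B^{\le N-1}$. Rough integral. For $\mathbf Y$ $\mathbf X$-controlled above $Y$ and $b\in B$, $\int_s^tY_r\,dX^b_r$ is the limit, as the mesh of partitions $\pi$ of $[s,t]$ tends to $0$, of $\sum_{[u,v]\in\pi}\sum_{\tau\in\mathcal F_B^{\le N-1}}\langle\tau,\mathbf Y_u\rangle\langle\mathbf X_{u,v},[\tau]_b\rangle$ (for $\alpha\in(\frac14,\frac12]$ this limit exists). Young integral. $\int_s^tG_r\,dH_r=\lim\sum_{[u,v]\in\pi}G_u(H_v-H_u)$ along partitions $\pi$ of $[s,t]$ with mesh tending to $0$. Bracket extension. Let $\hat A=A\cup\{(ij): i,j=1,\dots,d\}$. A bracket extension of $\mathbf X$ (over $A$) is an $\alpha$-Hölder planarly branched rough path $\hat{\mathbf X}$ over $\hat A$ such that $\langle\hat{\mathbf X}_{s,t},\tau\rangle=\langle\mathbf X_{s,t},\tau\rangle$ for all forests $\tau\in\mathcal F_A^{\le N}$ and $\langle\hat{\mathbf X}_{s,t},\bullet_{(ij)}\rangle=\langle\mathbf X_{s,t},\bullet_j\bullet_i-[\bullet_j]_i\rangle$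 for $i,j=1,\dots,d$. Its underlying path is $\hat X=(X^1,\dots,X^d,(\hat X^{(ij)})_{i,j})$ with $\hat X^{(ij)}_t-\hat X^{(ij)}_s=\langle\mathbf X_{s,t},\bullet_j\bullet_i-[\bullet_j]_i\rangle$. An $\mathbf X$-controlled path is regarded as $\hat{\mathbf X}$-controlled by giving it zero coefficient on forests containing a letter $(ij)$.
   Formalization: Added hypothesis, without which the claim fails: for all i,j and every forest τ over A with |τ|≤2, the pairing of the bracket extension with [τ]_{(ij)} is O(|t-s|^{(|τ|+2)α}), i.e. the letter (ij) counts with weight 2. *)

theory Defs
  imports "HOL-Analysis.Analysis" "HOL-Library.Multiset"
begin

section \<open>Decorated planar forests\<close>

text \<open>The finite decoration set is a type \<open>'b\<close> (of class \<open>finite\<close> where finiteness matters).\<close>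

datatype 'b ptree = Node 'b "'b ptree list"

type_synonym 'b forest = "'b ptree list"

fun tsize :: "'b ptree \<Rightarrow> nat" where
  "tsize (Node b ts) = Suc (sum_list (map tsize ts))"

definition fsize :: "'b forest \<Rightarrow> nat" where
  "fsize \<tau> = sum_list (map tsize \<tau>)"

definition forests_upto :: "nat \<Rightarrow> 'b forest set" where
  "forests_upto m = {\<tau>. fsize \<tau> \<le> m}"

abbreviation bplus :: "'b \<Rightarrow> 'b forest \<Rightarrow> 'b forest" where
  "bplus b \<tau> \<equiv> [Node b \<tau>]"

abbreviation bullet :: "'b \<Rightarrow> 'b forest" where
  "bullet b \<equiv> [Node b []]"

lemma fsize_simps [simp]:
  "fsize [] = 0"
  "fsize (Node b \<tau> # \<sigma>) = Suc (fsize \<tau>) + fsize \<sigma>"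
  "fsize (\<sigma> @ \<rho>) = fsize \<sigma> + fsize \<rho>"
  by (auto simp: fsize_def)

text \<open>Sums over \<open>forests_upto m\<close> below are therefore genuine finite sums.\<close>

lemma finite_forests_upto [simp]: "finite (forests_upto m :: 'b::finite forest set)"
proof (induction m)
  case 0
  have "\<tau> = []" if "fsize \<tau> = 0" for \<tau> :: "'b forest"
    using that by (cases \<tau>; cases "hd \<tau>") auto
  then have "(forests_upto 0 :: 'b forest set) \<subseteq> {[]}"
    by (auto simp: forests_upto_def)
  then show ?case by (rule finite_subset) simp
next
  case (Suc m)
  let ?S = "forests_upto m :: 'b forest set"
  have "(forests_upto (Suc m) :: 'b forest set)
      \<subseteq> insert [] ((\<lambda>(b, \<tau>, \<sigma>). Node b \<tau> # \<sigma>) ` (UNIV \<times> ?S \<times> ?S))"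
  proof
    fix x :: "'b forest" assume x: "x \<in> forests_upto (Suc m)"
    show "x \<in> insert [] ((\<lambda>(b, \<tau>, \<sigma>). Node b \<tau> # \<sigma>) ` (UNIV \<times> ?S \<times> ?S))"
    proof (cases x)
      case (Cons t \<sigma>)
      obtain b \<tau> where t: "t = Node b \<tau>" by (cases t)
      have "\<tau> \<in> ?S" "\<sigma> \<in> ?S" using x Cons t by (auto simp: forests_upto_def)
      then show ?thesis using Cons t by (auto intro!: image_eqI[of _ _ "(b, \<tau>, \<sigma>)"])
    qed simp
  qed
  then show ?case by (rule finite_subset) (use Suc in auto)
qed


section \<open>The Munthe-Kaas--Wright Hopf algebra\<close>

text \<open>
  On basis elements the shuffle product and the coproduct have natural number coefficients,
  so their values are written as multisets of forests, respectively of pairs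
  \<open>(\<sigma>, \<rho>)\<close> standing for \<open>\<sigma> \<otimes> \<rho>\<close>. (The library function \<^const>\<open>shuffles\<close> is a set and forgets
  multiplicities.) An element of the vector space is its coefficient function
  \<open>'b forest \<Rightarrow> real\<close>, so that pairing with a forest is evaluation.
\<close>

fun shuffle_mset :: "'a list \<Rightarrow> 'a list \<Rightarrow> 'a list multiset" where
  "shuffle_mset [] ys = {#ys#}"
| "shuffle_mset (x # xs) [] = {#x # xs#}"
| "shuffle_mset (x # xs) (y # ys) =
     image_mset ((#) x) (shuffle_mset xs (y # ys)) + image_mset ((#) y) (shuffle_mset (x # xs) ys)"

text \<open>Shuffle the left tensor factors, concatenate the right ones.\<close>

definition tensor_mult ::
  "('b forest \<times> 'b forest) multiset \<Rightarrow> ('b forest \<times> 'b forest) multiset \<Rightarrow>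
   ('b forest \<times> 'b forest) multiset" where
  "tensor_mult M K =
     (\<Sum>(\<sigma>1, \<rho>1)\<in>#M. \<Sum>(\<sigma>2, \<rho>2)\<in>#K. image_mset (\<lambda>\<sigma>. (\<sigma>, \<rho>1 @ \<rho>2)) (shuffle_mset \<sigma>1 \<sigma>2))"

function coprod :: "'b forest \<Rightarrow> ('b forest \<times> 'b forest) multiset" where
  "coprod [] = {#([], [])#}"
| "coprod (\<omega> @ [Node b \<tau>]) =
     {#(\<omega> @ [Node b \<tau>], [])#} +
     tensor_mult (coprod \<omega>) (image_mset (\<lambda>(\<sigma>, \<rho>). (\<sigma>, bplus b \<rho>)) (coprod \<tau>))"
proof -
  fix P :: bool and x :: "'b forest"
  assume *: "x = [] \<Longrightarrow> P" "\<And>\<omega> b \<tau>. x = \<omega> @ [Node b \<tau>] \<Longrightarrow> P"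
  show P
  proof (cases x rule: rev_cases)
    case (snoc \<omega> t)
    then show ?thesis using *(2) by (cases t) auto
  qed (use * in auto)
qed auto
termination by (relation "Wellfounded.measure fsize") auto

lemma coprod_two_bullets:
  "coprod (bullet j @ bullet i) =
     {#(bullet j @ bullet i, []), (bullet j, bullet i), ([], bullet j @ bullet i)#}"
  using coprod.simps(2)[of "bullet j" i "[]"] coprod.simps(2)[of "[]" j "[]"]
  by (simp add: tensor_mult_def)

lemma coprod_ladder:
  "coprod (bplus i (bullet j)) =
     {#(bplus i (bullet j), []), (bullet j, bullet i), ([], bplus i (bullet j))#}"
  using coprod.simps(2)[of "[]" i "bullet j"] coprod.simps(2)[of "[]" j "[]"]
  by (simp add: tensor_mult_def)

definition forest_vec :: "'b forest \<Rightarrow> 'b forest \<Rightarrow> real" where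
  "forest_vec \<tau> \<sigma> = of_bool (\<sigma> = \<tau>)"

definition star :: "('b forest \<Rightarrow> real) \<Rightarrow> ('b forest \<Rightarrow> real) \<Rightarrow> 'b forest \<Rightarrow> real" where
  "star x y \<tau> = (\<Sum>(\<sigma>, \<rho>)\<in>#coprod \<tau>. x \<sigma> * y \<rho>)"

definition trunc :: "nat \<Rightarrow> ('b forest \<Rightarrow> real) \<Rightarrow> 'b forest \<Rightarrow> real" where
  "trunc m x \<tau> = (if fsize \<tau> \<le> m then x \<tau> else 0)"


section \<open>Planarly branched rough paths and controlled paths\<close>

definition rp_order :: "real \<Rightarrow> nat" where
  "rp_order \<alpha> = nat \<lfloor>1 / \<alpha>\<rfloor>"

definition hoelder_bounded :: "real \<Rightarrow> real \<Rightarrow> (real \<Rightarrow> real \<Rightarrow> 'v::real_normed_vector) \<Rightarrow> bool" where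
  "hoelder_bounded T \<beta> A \<longleftrightarrow>
     (\<exists>C. \<forall>s\<in>{0..T}. \<forall>t\<in>{0..T}. s \<noteq> t \<longrightarrow> norm (A s t) / \<bar>t - s\<bar> powr \<beta> \<le> C)"

definition planar_rough_path ::
  "real \<Rightarrow> real \<Rightarrow> (real \<Rightarrow> real \<Rightarrow> 'b::finite forest \<Rightarrow> real) \<Rightarrow> bool" where
  "planar_rough_path \<alpha> T X \<longleftrightarrow>
     0 < \<alpha> \<and> \<alpha> \<le> 1 \<and>
     (\<forall>s\<in>{0..T}. \<forall>t\<in>{0..T}. \<forall>\<tau>. \<tau> \<notin> forests_upto (rp_order \<alpha>) \<longrightarrow> X s t \<tau> = 0) \<and>
     (\<forall>s\<in>{0..T}. \<forall>t\<in>{0..T}. X s t [] = 1) \<and>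
     (\<forall>s\<in>{0..T}. \<forall>u\<in>{0..T}. \<forall>t\<in>{0..T}. trunc (rp_order \<alpha>) (star (X s u) (X u t)) = X s t) \<and>
     (\<forall>s\<in>{0..T}. \<forall>t\<in>{0..T}. \<forall>\<sigma> \<tau>. fsize \<sigma> + fsize \<tau> \<le> rp_order \<alpha> \<longrightarrow>
        (\<Sum>\<rho>\<in>#shuffle_mset \<sigma> \<tau>. X s t \<rho>) = X s t \<sigma> * X s t \<tau>) \<and>
     (\<forall>\<tau>\<in>forests_upto (rp_order \<alpha>). hoelder_bounded T (real (fsize \<tau>) * \<alpha>) (\<lambda>s t. X s t \<tau>))"

definition above_path ::
  "real \<Rightarrow> (real \<Rightarrow> real \<Rightarrow> 'b forest \<Rightarrow> real) \<Rightarrow> (real \<Rightarrow> 'b \<Rightarrow> real) \<Rightarrow> bool" where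
  "above_path T X x \<longleftrightarrow> (\<forall>s\<in>{0..T}. \<forall>t\<in>{0..T}. \<forall>b. X s t (bullet b) = x t b - x s b)"

definition controlled_path ::
  "real \<Rightarrow> real \<Rightarrow> (real \<Rightarrow> real \<Rightarrow> 'b::finite forest \<Rightarrow> real) \<Rightarrow>
   (real \<Rightarrow> 'b forest \<Rightarrow> 'v::real_normed_vector) \<Rightarrow> bool" where
  "controlled_path \<alpha> T X Y \<longleftrightarrow>
     (\<forall>t\<in>{0..T}. \<forall>\<tau>. \<tau> \<notin> forests_upto (rp_order \<alpha> - 1) \<longrightarrow> Y t \<tau> = 0) \<and>
     (\<forall>\<tau>\<in>forests_upto (rp_order \<alpha> - 1).
        hoelder_bounded T ((real (rp_order \<alpha>) - real (fsize \<tau>)) * \<alpha>)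
          (\<lambda>s t. Y t \<tau> - (\<Sum>\<sigma>\<in>forests_upto (rp_order \<alpha> - 1).
                            star (X s t) (forest_vec \<tau>) \<sigma> *\<^sub>R Y s \<sigma>)))"


section \<open>Rough and Young integrals\<close>

text \<open>A partition of \<open>[s,t]\<close> is the list of its points in increasing order.\<close>

definition partition_pts :: "real \<Rightarrow> real \<Rightarrow> real list \<Rightarrow> bool" where
  "partition_pts s t p \<longleftrightarrow> p \<noteq> [] \<and> hd p = s \<and> last p = t \<and> sorted_wrt (<) p"

definition mesh_less :: "real list \<Rightarrow> real \<Rightarrow> bool" where
  "mesh_less p \<delta> \<longleftrightarrow> (\<forall>(u, v)\<in>set (zip p (tl p)). v - u < \<delta>)"

definition partition_filter :: "real \<Rightarrow> real \<Rightarrow> real list filter" where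
  "partition_filter s t = (INF \<delta>\<in>{0<..}. principal {p. partition_pts s t p \<and> mesh_less p \<delta>})"

definition partition_sum :: "(real \<Rightarrow> real \<Rightarrow> 'v::real_normed_vector) \<Rightarrow> real list \<Rightarrow> 'v" where
  "partition_sum \<Xi> p = (\<Sum>(u, v)\<leftarrow>zip p (tl p). \<Xi> u v)"

text \<open>For \<open>t < s\<close> the usual convention that the integral from \<open>s\<close> to \<open>t\<close> is minus
  the integral from \<open>t\<close> to \<open>s\<close> is used.\<close>

definition has_mesh_limit ::
  "(real \<Rightarrow> real \<Rightarrow> 'v::real_normed_vector) \<Rightarrow> real \<Rightarrow> real \<Rightarrow> 'v \<Rightarrow> bool" where
  "has_mesh_limit \<Xi> s t I \<longleftrightarrow>
     (if s \<le> t then (partition_sum \<Xi> \<longlongrightarrow> I) (partition_filter s t)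
      else (partition_sum \<Xi> \<longlongrightarrow> - I) (partition_filter t s))"

definition rough_sum_term ::
  "real \<Rightarrow> (real \<Rightarrow> real \<Rightarrow> 'b::finite forest \<Rightarrow> real) \<Rightarrow>
   (real \<Rightarrow> 'b forest \<Rightarrow> 'v::real_normed_vector) \<Rightarrow> 'b \<Rightarrow> real \<Rightarrow> real \<Rightarrow> 'v" where
  "rough_sum_term \<alpha> X Y b u v = (\<Sum>\<tau>\<in>forests_upto (rp_order \<alpha> - 1). X u v (bplus b \<tau>) *\<^sub>R Y u \<tau>)"

definition rough_integrable where
  "rough_integrable \<alpha> X Y b s t \<longleftrightarrow> (\<exists>I. has_mesh_limit (rough_sum_term \<alpha> X Y b) s t I)"

definition rough_integral where
  "rough_integral \<alpha> X Y b s t = (THE I. has_mesh_limit (rough_sum_term \<alpha> X Y b) s t I)"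

definition young_sum_term ::
  "(real \<Rightarrow> 'v::real_normed_vector) \<Rightarrow> (real \<Rightarrow> real) \<Rightarrow> real \<Rightarrow> real \<Rightarrow> 'v" where
  "young_sum_term G H u v = (H v - H u) *\<^sub>R G u"

definition young_integrable where
  "young_integrable G H s t \<longleftrightarrow> (\<exists>I. has_mesh_limit (young_sum_term G H) s t I)"

definition young_integral where
  "young_integral G H s t = (THE I. has_mesh_limit (young_sum_term G H) s t I)"


section \<open>Smooth functions and their lifts\<close>

definition partial_deriv ::
  "'d::finite \<Rightarrow> (real^'d \<Rightarrow> 'v::real_normed_vector) \<Rightarrow> real^'d \<Rightarrow> 'v" where
  "partial_deriv k G x = frechet_derivative G (at x) (axis k 1)"

primrec times_differentiable ::
  "nat \<Rightarrow> (real^'d::finite \<Rightarrow> 'v::real_normed_vector) \<Rightarrow> bool" where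
  "times_differentiable 0 G \<longleftrightarrow> continuous_on UNIV G"
| "times_differentiable (Suc m) G \<longleftrightarrow>
     (\<forall>x. G differentiable (at x)) \<and> (\<forall>k. times_differentiable m (partial_deriv k G))"

definition smooth :: "(real^'d::finite \<Rightarrow> 'v::real_normed_vector) \<Rightarrow> bool" where
  "smooth G \<longleftrightarrow> (\<forall>m. times_differentiable m G)"

fun lift_fun ::
  "(real^'d::finite \<Rightarrow> 'v::real_normed_vector) \<Rightarrow> (real \<Rightarrow> real^'d) \<Rightarrow> real \<Rightarrow> 'd forest \<Rightarrow> 'v" where
  "lift_fun G x t [] = G (x t)"
| "lift_fun G x t [Node k []] = partial_deriv k G (x t)"
| "lift_fun G x t [Node k [], Node l []] = partial_deriv k (partial_deriv l G) (x t)"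
| "lift_fun G x t _ = 0"


section \<open>Bracket extensions\<close>

text \<open>The extended alphabet is \<open>'d + 'd \<times> 'd\<close>: \<open>Inl i\<close> is the letter \<open>i\<close> and
  \<open>Inr (i, j)\<close> the letter \<open>(ij)\<close>.\<close>

definition embed :: "'d forest \<Rightarrow> ('d + 'd \<times> 'd) forest" where
  "embed \<tau> = map (map_ptree Inl) \<tau>"

lemma inj_embed: "inj embed"
proof -
  have "inj (map_ptree (Inl :: 'a \<Rightarrow> 'a + 'a \<times> 'a))" by (rule ptree.inj_map) simp
  then show ?thesis unfolding embed_def[abs_def] by (rule list.inj_map)
qed

definition extend_zero :: "(real \<Rightarrow> 'd forest \<Rightarrow> 'v::zero) \<Rightarrow> real \<Rightarrow> ('d + 'd \<times> 'd) forest \<Rightarrow> 'v" where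
  "extend_zero Y t \<tau> = (if \<tau> \<in> range embed then Y t (inv embed \<tau>) else 0)"

lemma extend_zero_embed: "extend_zero Y t (embed \<tau>) = Y t \<tau>"
  by (simp add: extend_zero_def inj_embed)

definition bracket_extension ::
  "real \<Rightarrow> real \<Rightarrow> (real \<Rightarrow> real \<Rightarrow> 'd::finite forest \<Rightarrow> real) \<Rightarrow>
   (real \<Rightarrow> real \<Rightarrow> ('d + 'd \<times> 'd) forest \<Rightarrow> real) \<Rightarrow> bool" where
  "bracket_extension \<alpha> T X Xh \<longleftrightarrow>
     planar_rough_path \<alpha> T Xh \<and>
     (\<forall>s\<in>{0..T}. \<forall>t\<in>{0..T}. \<forall>\<tau>\<in>forests_upto (rp_order \<alpha>). Xh s t (embed \<tau>) = X s t \<tau>) \<and>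
     (\<forall>s\<in>{0..T}. \<forall>t\<in>{0..T}. \<forall>i j.
        Xh s t (bullet (Inr (i, j))) = X s t (bullet j @ bullet i) - X s t (bplus i (bullet j)))"

definition underlying_path ::
  "(real \<Rightarrow> real^'d::finite) \<Rightarrow> ('d \<Rightarrow> 'd \<Rightarrow> real \<Rightarrow> real) \<Rightarrow> real \<Rightarrow> 'd + 'd \<times> 'd \<Rightarrow> real" where
  "underlying_path x xh t b = (case b of Inl i \<Rightarrow> x t $ i | Inr (i, j) \<Rightarrow> xh i j t)"

text \<open>
  A vertex decorated \<open>(ij)\<close> integrates against a path of Hoelder regularity \<open>2 * \<alpha>\<close>, whereas
  \<^const>\<open>planar_rough_path\<close> over the extended alphabet counts it, like any other vertex, with
  \<open>\<alpha>\<close> only. \<open>bracket_graded\<close> says that the trees with root \<open>(ij)\<close> over a forest in the old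
  letters scale accordingly. This does not follow from \<^const>\<open>bracket_extension\<close>, and the
  Ito formula is false without it: take one letter, \<open>X s t\<close> the unit,
  \<open>Xh s t\<close> the unit plus \<open>t - s\<close> times the tree with root \<open>(11)\<close> and two leaves \<open>1\<close>
  (admissible because \<open>3 * \<alpha> \<le> 1\<close>), and \<open>F x = x ^ 4\<close>. Then the rough integral of
  the second derivative is \<open>24 * (t - s)\<close> and every other term of the formula vanishes.
\<close>

definition bracket_graded ::
  "real \<Rightarrow> real \<Rightarrow> (real \<Rightarrow> real \<Rightarrow> ('d::finite + 'd \<times> 'd) forest \<Rightarrow> real) \<Rightarrow> bool" where
  "bracket_graded \<alpha> T Xh \<longleftrightarrow>
     (\<forall>i j. \<forall>\<tau>\<in>forests_upto (rp_order \<alpha> - 1).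
        hoelder_bounded T ((real (fsize \<tau>) + 2) * \<alpha>) (\<lambda>s t. Xh s t (bplus (Inr (i, j)) (embed \<tau>))))"

definition is_tilde_path ::
  "real \<Rightarrow> (real \<Rightarrow> real \<Rightarrow> ('d::finite + 'd \<times> 'd) forest \<Rightarrow> real) \<Rightarrow>
   ('d \<Rightarrow> 'd \<Rightarrow> 'd \<Rightarrow> real \<Rightarrow> real) \<Rightarrow> bool" where
  "is_tilde_path T Xh Xt \<longleftrightarrow>
     (\<forall>s\<in>{0..T}. \<forall>t\<in>{0..T}. \<forall>i j k.
        Xt i j k t - Xt i j k s =
          Xh s t (bullet (Inl k) @ bullet (Inl j) @ bullet (Inl i))
          - Xh s t (bplus (Inl i) (bullet (Inl k) @ bullet (Inl j)))
          - Xh s t (bplus (Inr (i, j)) (bullet (Inl k))))"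

end

theory Submission
  imports Defs
begin

text \<open>
  Every integral in the formula is the limit of Riemann sums \<open>\<Sigma> \<Xi>(u, v)\<close> of a germ with
  \<open>\<Xi>(u, v) - \<Xi>(u, m) - \<Xi>(m, v) = O(\<bar>v - u\<bar>\<^sup>4\<^sup>\<alpha>)\<close>; as \<open>4 \<alpha> > 1\<close>, the limits exist by the sewing lemma.
  The sum of all the germs is the third-order Taylor polynomial of \<open>F(X\<^sub>v) - F(X\<^sub>u)\<close> up to
  \<open>O(\<bar>v - u\<bar>\<^sup>4\<^sup>\<alpha>)\<close>: by symmetry of the higher derivatives the shuffle relations turn
  \<open>1/2 \<delta>X\<^sup>i \<delta>X\<^sup>j\<close> and \<open>1/6 \<delta>X\<^sup>i \<delta>X\<^sup>j \<delta>X\<^sup>k\<close> into \<open>\<langle>X, \<bullet>\<^sub>j \<bullet>\<^sub>i\<rangle>\<close> and \<open>\<langle>X, \<bullet>\<^sub>k \<bullet>\<^sub>j \<bullet>\<^sub>i\<rangle>\<close>, and what the two families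
  of rough integrals miss of these is exactly the increment of \<open>Xt\<close>. The errors add up to
  something that vanishes with the mesh, and the increments of \<open>F(X)\<close> telescope.
\<close>

section \<open>Taylor expansion and symmetry of partial derivatives\<close>

text \<open>The threshold \<open>4 \<alpha>\<close> is \<open>(N + 1) \<alpha>\<close> with N = 3:
  in the defect of a rough sum, the remainder of the controlled path at a forest of m vertices, of
  order \<open>(3 - m) \<alpha>\<close>, meets a tree of m + 1 vertices. The obstacle lies in the
  trees rooted at a letter (ij), for which counting vertices gives one \<alpha> too little. The
  trees \<open>[k]_(ij)\<close> enter the increments of \<open>Xt\<close>. Their exponent must be
  \<open>3 \<alpha>\<close>, so that Young sums of an \<alpha>-Hoelder integrand against
  \<open>Xt\<close> reach \<open>4 \<alpha>\<close>. The trees \<open>[k l]_(ij)\<close> come with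
  the second derivatives of the integrand in the bracket integral and have no partner in the Taylor
  polynomial of F. They must be of order \<open>4 \<alpha>\<close> to vanish with the mesh. Both
  exponents come from \<open>bracket_graded\<close>. The combination defining \<open>Xt\<close> is a
  path increment by Chen's relation: the bracket letter absorbs the mixed terms left by the word and
  the cherry. Sewing supplies existence of the limits only. The formula compares germs with
  increments of F(X), and no estimate of an integral by its germ is used.\<close>

lemma smooth_imp_differentiable: "smooth G \<Longrightarrow> G differentiable (at x)"
  unfolding smooth_def by (metis times_differentiable.simps(2))

lemma smooth_partial_deriv: "smooth G \<Longrightarrow> smooth (partial_deriv k G)"
  unfolding smooth_def by (metis times_differentiable.simps(2))

lemma smooth_continuous_on: "smooth G \<Longrightarrow> continuous_on S G"
  unfolding smooth_def by (metis times_differentiable.simps(1) continuous_on_subset subset_UNIV)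

text \<open>Differentiability is part of \<open>times_differentiable\<close>, so the derivative is a
  linear map and is determined by its values on the unit vectors.\<close>

lemma smooth_has_derivative:
  fixes G :: "real^'d::finite \<Rightarrow> 'v::real_normed_vector"
  assumes "smooth G"
  shows "(G has_derivative (\<lambda>h. \<Sum>k\<in>UNIV. (h $ k) *\<^sub>R partial_deriv k G x)) (at x)"
proof -
  have D: "(G has_derivative frechet_derivative G (at x)) (at x)"
    using smooth_imp_differentiable[OF assms] frechet_derivative_works by blast
  have "frechet_derivative G (at x) h = (\<Sum>k\<in>UNIV. (h $ k) *\<^sub>R partial_deriv k G x)" for h
  proof -
    interpret linear "frechet_derivative G (at x)"
      using D has_derivative_linear by blast
    have "frechet_derivative G (at x) h = frechet_derivative G (at x) (\<Sum>k\<in>UNIV. (h $ k) *\<^sub>R axis k 1)"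
      using basis_expansion[of h] by (simp add: scalar_mult_eq_scaleR)
    then show ?thesis
      by (simp add: sum scaleR partial_deriv_def)
  qed
  with D show ?thesis by (metis (no_types, lifting) ext)
qed

lemma smooth_has_vector_derivative_line:
  fixes G :: "real^'d::finite \<Rightarrow> 'v::real_normed_vector"
  assumes "smooth G"
  shows "((\<lambda>r. G (x + r *\<^sub>R h)) has_vector_derivative
    (\<Sum>k\<in>UNIV. (h $ k) *\<^sub>R partial_deriv k G (x + r *\<^sub>R h))) (at r)"
proof -
  have 1: "((\<lambda>r. x + r *\<^sub>R h) has_derivative (\<lambda>s. s *\<^sub>R h)) (at r)"
    by (auto intro!: derivative_eq_intros)
  show ?thesis
    using diff_chain_at[OF 1 smooth_has_derivative[OF assms]]
    by (simp add: o_def has_vector_derivative_def scaleR_sum_right)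
qed

text \<open>The n-th derivative of G at x evaluated at (h, ..., h), that is, the n-th derivative of
  \<open>G (x + r h)\<close> in r at r = 0. The recursion moves a partial derivative onto G, so
  inductions run over all G at once.\<close>

primrec iterated_dir_deriv ::
  "nat \<Rightarrow> (real^'d::finite \<Rightarrow> 'v::real_normed_vector) \<Rightarrow> real^'d \<Rightarrow> real^'d \<Rightarrow> 'v" where
  "iterated_dir_deriv 0 G h x = G x"
| "iterated_dir_deriv (Suc n) G h x =
     (\<Sum>k\<in>UNIV. (h $ k) *\<^sub>R iterated_dir_deriv n (partial_deriv k G) h x)"

lemma iterated_dir_deriv_has_vector_derivative:
  assumes "smooth G"
  shows "((\<lambda>r. iterated_dir_deriv n G h (x + r *\<^sub>R h)) has_vector_derivative
    iterated_dir_deriv (Suc n) G h (x + r *\<^sub>R h)) (at r)"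
  using assms
proof (induction n arbitrary: G)
  case 0
  then show ?case using smooth_has_vector_derivative_line by simp
next
  case (Suc n)
  \<comment> \<open>Fixed instances of the recursion open one sum on each side; the terms in
    \<open>partial_deriv k G\<close> stay folded and match the induction hypothesis.\<close>
  show ?case unfolding iterated_dir_deriv.simps(2)[of "Suc n"]
    by (subst iterated_dir_deriv.simps(2)[of n], intro has_vector_derivative_sum
        bounded_linear.has_vector_derivative[OF bounded_linear_scaleR_right] Suc smooth_partial_deriv)
qed

text \<open>The partial derivatives are continuous, hence bounded on K. The direction h enters only
  through n of its coordinates, so one constant serves all h.\<close>

lemma iterated_dir_deriv_bound:
  assumes "smooth G" "compact K"
  shows "\<exists>M\<ge>0. \<forall>x\<in>K. \<forall>h. norm (iterated_dir_deriv n G h x) \<le> M * norm h ^ n"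
  using assms(1)
proof (induction n arbitrary: G)
  case 0
  have "bounded (G ` K)"
    using 0 assms(2) compact_continuous_image compact_imp_bounded smooth_continuous_on by blast
  then obtain M where "\<forall>x\<in>K. norm (G x) \<le> M" by (auto simp: bounded_iff)
  \<comment> \<open>If K is empty, M may be negative.\<close>
  then show ?case by (intro exI[of _ "max M 0"]) (auto simp: le_max_iff_disj)
next
  case (Suc n)
  then have "\<forall>k. \<exists>M\<ge>0. \<forall>x\<in>K. \<forall>h. norm (iterated_dir_deriv n (partial_deriv k G) h x) \<le> M * norm h ^ n"
    using smooth_partial_deriv by blast
  then obtain M where M0: "\<And>k. M k \<ge> 0"
    and M: "\<And>k x h. x \<in> K \<Longrightarrow> norm (iterated_dir_deriv n (partial_deriv k G) h x) \<le> M k * norm h ^ n"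
    by metis
  have "norm (iterated_dir_deriv (Suc n) G h x) \<le> (\<Sum>k\<in>UNIV. M k) * norm h ^ Suc n" if "x \<in> K" for x h
  proof -
    have "norm (iterated_dir_deriv (Suc n) G h x)
        \<le> (\<Sum>k\<in>UNIV. norm ((h $ k) *\<^sub>R iterated_dir_deriv n (partial_deriv k G) h x))"
      unfolding iterated_dir_deriv.simps by (rule norm_sum)
    also have "\<dots> \<le> (\<Sum>k\<in>UNIV. norm h * (M k * norm h ^ n))"
      by (intro sum_mono) (auto intro!: mult_mono M that component_le_norm_cart)
    finally show ?thesis by (simp add: sum_distrib_right sum_distrib_left mult_ac)
  qed
  then show ?case using M0 by (intro exI[of _ "\<Sum>k\<in>UNIV. M k"]) (auto intro: sum_nonneg simp del: iterated_dir_deriv.simps)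
qed

text \<open>Pairing the remainder with itself reduces the vector-valued expansion to Maclaurin's
  formula for a real function on the segment.\<close>

lemma taylor_bound:
  fixes G :: "real^'d::finite \<Rightarrow> 'v::real_inner"
  assumes "smooth G" "compact K" "convex K" "0 < n"
  shows "\<exists>M\<ge>0. \<forall>x\<in>K. \<forall>y\<in>K.
    norm (G y - (\<Sum>m<n. (1 / fact m) *\<^sub>R iterated_dir_deriv m G (y - x) x)) \<le> M * norm (y - x) ^ n"
proof -
  obtain M where M0: "M \<ge> 0" and M: "\<And>x h. x \<in> K \<Longrightarrow> norm (iterated_dir_deriv n G h x) \<le> M * norm h ^ n"
    using iterated_dir_deriv_bound[OF assms(1,2)] by blast
  have "norm (G y - (\<Sum>m<n. (1 / fact m) *\<^sub>R iterated_dir_deriv m G (y - x) x)) \<le> M * norm (y - x) ^ n"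
    if xy: "x \<in> K" "y \<in> K" for x y
  proof -
    define h where "h = y - x"
    define R where "R = G y - (\<Sum>m<n. (1 / fact m) *\<^sub>R iterated_dir_deriv m G h x)"
    define d where "d m r = R \<bullet> iterated_dir_deriv m G h (x + r *\<^sub>R h)" for m r
    have "DERIV (d m) r :> d (Suc m) r" for m r
      using iterated_dir_deriv_has_vector_derivative[OF assms(1), of m h x r]
      unfolding d_def has_real_derivative_iff_has_vector_derivative
      by (rule bounded_linear.has_vector_derivative[OF bounded_linear_inner_right])
    then obtain t where t: "0 < t" "t \<le> 1"
      and eq: "d 0 1 = (\<Sum>m<n. d m 0 / fact m * 1 ^ m) + d n t / fact n * 1 ^ n"
      using Maclaurin2[of 1 d "d 0" n] by auto
    have "R \<bullet> R = d 0 1 - (\<Sum>m<n. d m 0 / fact m)"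
      unfolding d_def by (subst (2) R_def) (simp add: h_def inner_diff_right inner_sum_right)
    also have "\<dots> = d n t / fact n" using eq by simp
    \<comment> \<open>The factor \<open>1 / fact n\<close> is given away, since only the order in
      \<open>norm h\<close> matters.\<close>
    also have "\<dots> \<le> \<bar>d n t\<bar>"
      by (simp add: divide_le_eq mult_le_cancel_left1 order_trans[OF abs_ge_self])
    also have "\<dots> \<le> norm R * norm (iterated_dir_deriv n G h (x + t *\<^sub>R h))"
      unfolding d_def by (rule Cauchy_Schwarz_ineq2)
    also have "\<dots> \<le> norm R * (M * norm h ^ n)"
    proof (intro mult_left_mono M)
      have "x + t *\<^sub>R h = (1 - t) *\<^sub>R x + t *\<^sub>R y" by (simp add: h_def algebra_simps)
      then show "x + t *\<^sub>R h \<in> K" using convexD_alt[OF assms(3) xy, of t] t by simp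
    qed simp
    finally have "norm R * norm R \<le> norm R * (M * norm h ^ n)"
      by (simp add: dot_square_norm power2_eq_square)
    then have "norm R \<le> M * norm h ^ n"
      using M0 by (cases "norm R = 0") (auto simp: mult_le_cancel_left)
    then show ?thesis by (simp add: R_def h_def)
  qed
  with M0 show ?thesis by blast
qed

text \<open>The mean value theorem, applied along k and then along l. It fails for vector-valued
  functions, hence the pairing with a fixed w.\<close>

lemma mixed_difference_mean_value:
  fixes G :: "real^'d::finite \<Rightarrow> 'v::real_inner"
  assumes G: "smooth G" and e: "0 < e"
  shows "\<exists>p. dist p x \<le> 2 * e \<and>
    (G (x + e *\<^sub>R axis k 1 + e *\<^sub>R axis l 1) - G (x + e *\<^sub>R axis k 1) - G (x + e *\<^sub>R axis l 1) + G x) \<bullet> w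
      = e\<^sup>2 * (partial_deriv l (partial_deriv k G) p \<bullet> w)"
proof -
  have line: "((\<lambda>r. H (z + r *\<^sub>R axis k 1) \<bullet> w) has_real_derivative
      partial_deriv k H (z + r *\<^sub>R axis k 1) \<bullet> w) (at r)"
    if "smooth H" for H :: "real^'d \<Rightarrow> 'v" and z k r
  proof -
    have "((\<lambda>r. H (z + r *\<^sub>R axis k 1)) has_vector_derivative
      partial_deriv k H (z + r *\<^sub>R axis k 1)) (at r)"
      using smooth_has_vector_derivative_line[OF that, of z "axis k 1" r]
      by (simp add: axis_def if_distrib[of "\<lambda>c. c *\<^sub>R _"] cong: if_cong)
    then show ?thesis
      unfolding has_real_derivative_iff_has_vector_derivative
      by (rule bounded_linear.has_vector_derivative[OF bounded_linear_inner_left])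
  qed
  \<comment> \<open>The increment along l after a displacement r along k: \<open>?u e - ?u 0\<close>
    is the mixed difference paired with w.\<close>
  let ?u = "\<lambda>r. G (x + e *\<^sub>R axis l 1 + r *\<^sub>R axis k 1) \<bullet> w - G (x + r *\<^sub>R axis k 1) \<bullet> w"
  have "\<exists>a>0. a < e \<and> ?u e - ?u 0 = (e - 0) *
      (partial_deriv k G (x + e *\<^sub>R axis l 1 + a *\<^sub>R axis k 1) \<bullet> w - partial_deriv k G (x + a *\<^sub>R axis k 1) \<bullet> w)"
    by (rule MVT2[OF e]) (intro DERIV_diff line G)
  then obtain a where a: "0 < a" "a < e" and ua: "?u e - ?u 0 = e *
      (partial_deriv k G (x + e *\<^sub>R axis l 1 + a *\<^sub>R axis k 1) \<bullet> w - partial_deriv k G (x + a *\<^sub>R axis k 1) \<bullet> w)"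
    by auto
  let ?v = "\<lambda>r. partial_deriv k G ((x + a *\<^sub>R axis k 1) + r *\<^sub>R axis l 1) \<bullet> w"
  have "\<exists>b>0. b < e \<and> ?v e - ?v 0 = (e - 0) *
      (partial_deriv l (partial_deriv k G) ((x + a *\<^sub>R axis k 1) + b *\<^sub>R axis l 1) \<bullet> w)"
    by (rule MVT2[OF e]) (intro line smooth_partial_deriv G)
  then obtain b where b: "0 < b" "b < e" and vb: "?v e - ?v 0 = e *
      (partial_deriv l (partial_deriv k G) ((x + a *\<^sub>R axis k 1) + b *\<^sub>R axis l 1) \<bullet> w)"
    by auto
  show ?thesis
  proof (intro exI conjI)
    show "dist (x + a *\<^sub>R axis k 1 + b *\<^sub>R axis l 1) x \<le> 2 * e"
    proof -
      have "dist (x + a *\<^sub>R axis k 1 + b *\<^sub>R axis l 1) x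
          = norm (a *\<^sub>R axis k 1 + b *\<^sub>R axis l 1 :: real^'d)"
        by (simp add: dist_norm algebra_simps)
      also have "\<dots> \<le> \<bar>a\<bar> + \<bar>b\<bar>"
        using norm_triangle_ineq[of "a *\<^sub>R axis k 1 :: real^'d" "b *\<^sub>R axis l 1"] by simp
      finally show ?thesis using a b by simp
    qed
    show "(G (x + e *\<^sub>R axis k 1 + e *\<^sub>R axis l 1) - G (x + e *\<^sub>R axis k 1) - G (x + e *\<^sub>R axis l 1) + G x) \<bullet> w
      = e\<^sup>2 * (partial_deriv l (partial_deriv k G) (x + a *\<^sub>R axis k 1 + b *\<^sub>R axis l 1) \<bullet> w)"
      using ua vb by (simp add: algebra_simps power2_eq_square)
  qed
qed

text \<open>The mixed difference is symmetric in k and l, so the two mixed derivatives agree, when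
  paired with w, at points p n and q n that tend to x. Continuity carries this to x. Taking for w
  the difference of the two sides turns the conclusion into
  \<open>w \<bullet> w = 0\<close>.\<close>

lemma partial_deriv_commute:
  fixes G :: "real^'d::finite \<Rightarrow> 'v::real_inner"
  assumes G: "smooth G"
  shows "partial_deriv k (partial_deriv l G) x = partial_deriv l (partial_deriv k G) x"
proof -
  define w where "w = partial_deriv k (partial_deriv l G) x - partial_deriv l (partial_deriv k G) x"
  define e :: "nat \<Rightarrow> real" where "e n = 1 / Suc n" for n
  have e0: "e n > 0" for n by (simp add: e_def)
  have elim: "(\<lambda>n. 2 * e n) \<longlonglongrightarrow> 0"
    using tendsto_mult[OF tendsto_const[of 2] LIMSEQ_inverse_real_of_nat]
    by (simp add: e_def inverse_eq_divide)
  have "\<forall>n. \<exists>p. dist p x \<le> 2 * e n \<and>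
      (G (x + e n *\<^sub>R axis k 1 + e n *\<^sub>R axis l 1) - G (x + e n *\<^sub>R axis k 1) - G (x + e n *\<^sub>R axis l 1) + G x) \<bullet> w
      = (e n)\<^sup>2 * (partial_deriv l (partial_deriv k G) p \<bullet> w)"
    using mixed_difference_mean_value[OF G e0] by blast
  from choice[OF this] obtain p where p: "\<And>n. dist (p n) x \<le> 2 * e n" and peq: "\<And>n.
      (G (x + e n *\<^sub>R axis k 1 + e n *\<^sub>R axis l 1) - G (x + e n *\<^sub>R axis k 1) - G (x + e n *\<^sub>R axis l 1) + G x) \<bullet> w
      = (e n)\<^sup>2 * (partial_deriv l (partial_deriv k G) (p n) \<bullet> w)"
    by auto
  have "\<forall>n. \<exists>p. dist p x \<le> 2 * e n \<and>
      (G (x + e n *\<^sub>R axis l 1 + e n *\<^sub>R axis k 1) - G (x + e n *\<^sub>R axis l 1) - G (x + e n *\<^sub>R axis k 1) + G x) \<bullet> w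
      = (e n)\<^sup>2 * (partial_deriv k (partial_deriv l G) p \<bullet> w)"
    using mixed_difference_mean_value[OF G e0] by blast
  from choice[OF this] obtain q where q: "\<And>n. dist (q n) x \<le> 2 * e n" and qeq: "\<And>n.
      (G (x + e n *\<^sub>R axis l 1 + e n *\<^sub>R axis k 1) - G (x + e n *\<^sub>R axis l 1) - G (x + e n *\<^sub>R axis k 1) + G x) \<bullet> w
      = (e n)\<^sup>2 * (partial_deriv k (partial_deriv l G) (q n) \<bullet> w)"
    by auto
  have pq: "partial_deriv l (partial_deriv k G) (p n) \<bullet> w = partial_deriv k (partial_deriv l G) (q n) \<bullet> w" for n
  proof -
    have "(e n)\<^sup>2 * (partial_deriv l (partial_deriv k G) (p n) \<bullet> w)
        = (e n)\<^sup>2 * (partial_deriv k (partial_deriv l G) (q n) \<bullet> w)"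
      unfolding peq[symmetric] qeq[symmetric] by (simp add: algebra_simps)
    then show ?thesis using e0[of n] by simp
  qed
  have lim: "(\<lambda>n. H (r n) \<bullet> w) \<longlonglongrightarrow> H x \<bullet> w"
    if "smooth H" "\<And>n. dist (r n) x \<le> 2 * e n" for H :: "real^'d \<Rightarrow> 'v" and r
  proof -
    have "r \<longlonglongrightarrow> x"
      by (rule metric_tendsto_imp_tendsto[OF elim]) (use that e0 in \<open>auto simp: abs_of_pos\<close>)
    moreover have "isCont H x"
      using smooth_continuous_on[OF that(1), of UNIV] by (simp add: continuous_on_eq_continuous_at)
    ultimately show ?thesis by (intro tendsto_inner isCont_tendsto_compose[of x H] tendsto_const)
  qed
  have "(\<lambda>n. partial_deriv l (partial_deriv k G) (p n) \<bullet> w) \<longlonglongrightarrow> partial_deriv l (partial_deriv k G) x \<bullet> w"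
    by (intro lim smooth_partial_deriv G p)
  moreover have "(\<lambda>n. partial_deriv l (partial_deriv k G) (p n) \<bullet> w) \<longlonglongrightarrow> partial_deriv k (partial_deriv l G) x \<bullet> w"
    unfolding pq by (intro lim smooth_partial_deriv G q)
  ultimately have "partial_deriv l (partial_deriv k G) x \<bullet> w = partial_deriv k (partial_deriv l G) x \<bullet> w"
    by (rule LIMSEQ_unique)
  then have "w \<bullet> w = 0" by (simp add: w_def inner_diff_left)
  then show ?thesis by (simp add: w_def)
qed

section \<open>Partition sums and the sewing lemma\<close>

lemma partition_sum_simps [simp]:
  "partition_sum \<Xi> [] = 0"
  "partition_sum \<Xi> [a] = 0"
  "partition_sum \<Xi> (a # b # p) = \<Xi> a b + partition_sum \<Xi> (b # p)"
  by (simp_all add: partition_sum_def)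

lemma mesh_less_simps [simp]:
  "mesh_less [a] \<delta>"
  "mesh_less (a # b # p) \<delta> \<longleftrightarrow> b - a < \<delta> \<and> mesh_less (b # p) \<delta>"
  by (auto simp: mesh_less_def)

lemma mesh_less_mono: "mesh_less p \<delta> \<Longrightarrow> \<delta> \<le> \<delta>' \<Longrightarrow> mesh_less p \<delta>'"
  by (fastforce simp: mesh_less_def)

lemma partition_sum_append:
  "partition_sum \<Xi> (l @ m # r) = partition_sum \<Xi> (l @ [m]) + partition_sum \<Xi> (m # r)"
proof (induction l)
  case (Cons a l)
  then show ?case by (cases l) (auto simp: add.assoc)
qed simp

text \<open>Cuts a partition at one of its intervals rather than at a point, as is needed when the
  midpoint of the whole interval is not a partition point.\<close>

lemma partition_sum_append2:
  assumes "l \<noteq> []" "r \<noteq> []"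
  shows "partition_sum \<Xi> (l @ r) = partition_sum \<Xi> l + \<Xi> (last l) (hd r) + partition_sum \<Xi> r"
proof -
  obtain m r' where r: "r = m # r'" using assms by (cases r) auto
  obtain l' k where l: "l = l' @ [k]" using assms by (cases l rule: rev_cases) auto
  show ?thesis unfolding l r using partition_sum_append[of \<Xi> l' k "m # r'"] by (simp add: add.assoc)
qed

lemma partition_sum_cong:
  assumes "sorted_wrt (<) p" "\<And>u v. u < v \<Longrightarrow> u \<in> set p \<Longrightarrow> v \<in> set p \<Longrightarrow> \<Xi> u v = \<Xi>' u v"
  shows "partition_sum \<Xi> p = partition_sum \<Xi>' p"
  using assms
proof (induction p)
  case (Cons a p)
  then show ?case by (cases p) auto
qed simp

lemma partition_pts_set:
  assumes "partition_pts s t p"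
  shows "set p \<subseteq> {s..t}" "s \<in> set p" "t \<in> set p" "s \<le> t"
proof -
  have p: "p \<noteq> []" "hd p = s" "last p = t" "sorted_wrt (<) p"
    using assms by (auto simp: partition_pts_def)
  have 1: "s \<le> z" if "z \<in> set p" for z
    using p that by (cases p) force+
  have 2: "z \<le> t" if "z \<in> set p" for z
    using p that by (cases p rule: rev_cases) (force simp: sorted_wrt_append)+
  show "set p \<subseteq> {s..t}" using 1 2 by auto
  show "s \<in> set p" "t \<in> set p" using p hd_in_set last_in_set by blast+
  then show "s \<le> t" using 1 by blast
qed

lemma partition_pts_single [simp]: "partition_pts s t [a] \<longleftrightarrow> a = s \<and> a = t"
  by (auto simp: partition_pts_def)

lemma partition_pts_Cons2:
  "partition_pts s t (a # b # p) \<longleftrightarrow> a = s \<and> a < b \<and> partition_pts b t (b # p)"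
  unfolding partition_pts_def by (subst sorted_wrt2) auto

lemma partition_pts_refl: "partition_pts s s p \<Longrightarrow> p = [s]"
proof -
  assume p: "partition_pts s s p"
  show "p = [s]"
  proof (cases p rule: remdups_adj.cases)
    case 1
    then show ?thesis using p by (simp add: partition_pts_def)
  next
    case (2 x)
    then show ?thesis using p by simp
  next
    case (3 x y xs)
    then show ?thesis using p partition_pts_set(4)[of y s "y # xs"] by (auto simp: partition_pts_Cons2)
  qed
qed

lemma partition_pts_append:
  assumes "partition_pts s t (l @ m # r)"
  shows "partition_pts s m (l @ [m])" "partition_pts m t (m # r)"
  using assms by (auto simp: partition_pts_def sorted_wrt_append hd_append)

text \<open>Steps of length \<open>\<delta> / 2\<close> keep the mesh strictly below \<delta>; the
  induction is on a number of steps that suffices to reach t.\<close>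

lemma ex_partition_mesh_less:
  assumes "s \<le> t" "0 < \<delta>"
  shows "\<exists>p. partition_pts s t p \<and> mesh_less p \<delta>"
proof -
  have "\<exists>p. partition_pts s t p \<and> mesh_less p \<delta>" if "s \<le> t" "t - s \<le> real n * (\<delta> / 2)" for n s
    using that
  proof (induction n arbitrary: s)
    case 0
    then show ?case by (intro exI[of _ "[s]"]) auto
  next
    case (Suc n)
    show ?case
    proof (cases "t - s \<le> \<delta> / 2")
      case True
      then show ?thesis using Suc.prems assms(2)
        by (intro exI[of _ "if s = t then [s] else [s, t]"]) (auto simp: partition_pts_Cons2)
    next
      case False
      then obtain p where p: "partition_pts (s + \<delta> / 2) t p" "mesh_less p \<delta>"
        using Suc.IH[of "s + \<delta> / 2"] Suc.prems by (auto simp: field_simps)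
      then obtain p' where "p = (s + \<delta> / 2) # p'" by (cases p) (auto simp: partition_pts_def)
      with p show ?thesis using assms(2)
        by (intro exI[of _ "s # p"]) (auto simp: partition_pts_Cons2)
    qed
  qed
  moreover obtain n :: nat where "t - s \<le> real n * (\<delta> / 2)"
    using reals_Archimedean3[of "\<delta> / 2"] assms(2) by (metis half_gt_zero less_imp_le)
  ultimately show ?thesis using assms(1) by blast
qed

section \<open>Limits along partitions of vanishing mesh\<close>

lemma eventually_partition_filter:
  "eventually P (partition_filter s t) \<longleftrightarrow>
    (\<exists>\<delta>>0. \<forall>p. partition_pts s t p \<and> mesh_less p \<delta> \<longrightarrow> P p)"
  unfolding partition_filter_def
proof (subst eventually_INF_base)
  show "\<exists>x\<in>{0<..}. principal {p. partition_pts s t p \<and> mesh_less p x}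
      \<le> inf (principal {p. partition_pts s t p \<and> mesh_less p a}) (principal {p. partition_pts s t p \<and> mesh_less p b})"
    if "a \<in> {0<..}" "b \<in> {0<..}" for a b :: real
    using that by (intro bexI[of _ "min a b"]) (auto intro: mesh_less_mono)
qed (auto simp: eventually_principal)

lemma partition_filter_nontrivial: "s \<le> t \<Longrightarrow> partition_filter s t \<noteq> bot"
  using ex_partition_mesh_less by (auto simp: trivial_limit_def eventually_partition_filter)

text \<open>One factor v - u is kept, and over a partition these add up to its length; the remaining
  exponent \<open>\<theta> - 1\<close> yields a factor that vanishes with the mesh.\<close>

lemma powr_le_mult_powr:
  fixes u v :: real
  assumes "u < v" "v - u \<le> \<delta>" "1 < \<theta>"
  shows "(v - u) powr \<theta> \<le> (v - u) * \<delta> powr (\<theta> - 1)"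
proof -
  have "(v - u) powr \<theta> = (v - u) * (v - u) powr (\<theta> - 1)"
    using powr_add[of "v - u" 1 "\<theta> - 1"] assms by simp
  also have "\<dots> \<le> (v - u) * \<delta> powr (\<theta> - 1)"
    using assms by (intro mult_left_mono powr_mono2) auto
  finally show ?thesis .
qed

text \<open>Cutting a partition at the midpoint of the interval leaves two partitions of intervals of at
  most half the length; since \<open>\<theta> > 1\<close> the halved errors are summable.\<close>

lemma sewing_bound_aux:
  fixes \<Xi> :: "real \<Rightarrow> real \<Rightarrow> 'v::real_normed_vector"
  assumes \<theta>: "1 < \<theta>" and C: "0 \<le> C"
    and refl: "\<And>u. \<Xi> u u = 0"
    and \<delta>: "\<And>u m v. S \<le> u \<Longrightarrow> u < m \<Longrightarrow> m < v \<Longrightarrow> v \<le> E \<Longrightarrow>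
      norm (\<Xi> u v - \<Xi> u m - \<Xi> m v) \<le> C * (v - u) powr \<theta>"
    and p: "partition_pts a b p" "S \<le> a" "b \<le> E"
  shows "norm (partition_sum \<Xi> p - \<Xi> a b) \<le> 2 * C / (1 - 2 powr (1 - \<theta>)) * (b - a) powr \<theta>"
  using p
proof (induction "length p" arbitrary: p a b rule: less_induct)
  case less
  define K where "K = 2 * C / (1 - 2 powr (1 - \<theta>))"
  have q: "2 powr (1 - \<theta>) < 1" using powr_less_mono[of "1 - \<theta>" 0 "2::real"] \<theta> by simp
  \<comment> \<open>K is the fixed point of the recursion: two halves contribute
    \<open>2 K ((b - a) / 2) powr \<theta>\<close>, which is \<open>K 2 powr (1 - \<theta>)\<close>
    times \<open>(b - a) powr \<theta>\<close>, and inserting two points adds 2 C.\<close>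
  have K: "K * 2 powr (1 - \<theta>) + 2 * C = K" "0 \<le> K"
    using q C \<theta> by (simp_all add: K_def divide_simps) (simp add: algebra_simps)
  have d: "norm (\<Xi> u v - \<Xi> u m - \<Xi> m v) \<le> C * (v - u) powr \<theta>"
    if "S \<le> u" "u \<le> m" "m \<le> v" "v \<le> E" for u m v
    using \<delta>[of u m v] that C refl by (cases "u = m"; cases "m = v") auto
  have pp: "p \<noteq> []" "hd p = a" "last p = b" "sorted_wrt (<) p"
    using less.prems by (auto simp: partition_pts_def)
  have ab: "a \<le> b" using partition_pts_set less.prems by blast
  show ?case
  proof (cases "a = b")
    case True
    then have "p = [b]" using less.prems(1) by (simp add: partition_pts_refl)
    then show ?thesis using True refl by simp
  next
    case False
    define c where "c = (a + b) / 2"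
    \<comment> \<open>The interval from \<open>last l\<close> to \<open>hd r\<close> straddles the
      midpoint, so l and r each span at most half of the length; both are nonempty, hence both are
      shorter than p.\<close>
    define l where "l = takeWhile (\<lambda>x. x \<le> c) p"
    define r where "r = dropWhile (\<lambda>x. x \<le> c) p"
    have p_eq: "p = l @ r" by (simp add: l_def r_def)
    have l: "l \<noteq> []" using pp(1,2) ab by (cases p) (auto simp: l_def c_def)
    have "\<not> b \<le> c" using ab False by (simp add: c_def)
    then have r: "r \<noteq> []"
      using pp(1,3) last_in_set[of p] by (auto simp: r_def dropWhile_eq_Nil_conv)
    have m1: "last l \<le> c" using set_takeWhileD[of "last l" _ p] last_in_set[OF l] by (auto simp: l_def)
    have m2: "c < hd r" using hd_dropWhile[of "\<lambda>x. x \<le> c" p] r by (auto simp: r_def)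
    have pl: "partition_pts a (last l) l" and pr: "partition_pts (hd r) b r"
      using pp l r by (auto simp: partition_pts_def p_eq sorted_wrt_append)
    note sl = partition_pts_set(4)[OF pl] and sr = partition_pts_set(4)[OF pr]
    have "norm (partition_sum \<Xi> l - \<Xi> a (last l)) \<le> K * (last l - a) powr \<theta>"
      unfolding K_def using r less.prems m1 m2 sr by (intro less.hyps pl) (auto simp: p_eq)
    also have "\<dots> \<le> K * ((b - a) / 2) powr \<theta>"
      using K m1 sl \<theta> by (intro mult_left_mono powr_mono2) (auto simp: c_def field_simps)
    finally have 1: "norm (partition_sum \<Xi> l - \<Xi> a (last l)) \<le> K * ((b - a) / 2) powr \<theta>" .
    have "norm (partition_sum \<Xi> r - \<Xi> (hd r) b) \<le> K * (b - hd r) powr \<theta>"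
      unfolding K_def using l less.prems m1 m2 sl by (intro less.hyps pr) (auto simp: p_eq)
    also have "\<dots> \<le> K * ((b - a) / 2) powr \<theta>"
      using K m2 sr \<theta> by (intro mult_left_mono powr_mono2) (auto simp: c_def field_simps)
    finally have 2: "norm (partition_sum \<Xi> r - \<Xi> (hd r) b) \<le> K * ((b - a) / 2) powr \<theta>" .
    \<comment> \<open>Two insertions split the germ over [a, b] into three: \<open>hd r\<close> into
      [a, b], then \<open>last l\<close> into [a, hd r].\<close>
    have 3: "norm (\<Xi> a b - \<Xi> a (hd r) - \<Xi> (hd r) b) \<le> C * (b - a) powr \<theta>"
      using less.prems m1 m2 sl sr by (intro d) auto
    have "norm (\<Xi> a (hd r) - \<Xi> a (last l) - \<Xi> (last l) (hd r)) \<le> C * (hd r - a) powr \<theta>"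
      using less.prems m1 m2 sl sr by (intro d) auto
    also have "\<dots> \<le> C * (b - a) powr \<theta>"
      using C sl m1 m2 sr \<theta> by (intro mult_left_mono powr_mono2) auto
    finally have 4: "norm (\<Xi> a (hd r) - \<Xi> a (last l) - \<Xi> (last l) (hd r)) \<le> C * (b - a) powr \<theta>" .
    have eq: "partition_sum \<Xi> p - \<Xi> a b =
        (partition_sum \<Xi> l - \<Xi> a (last l)) + (partition_sum \<Xi> r - \<Xi> (hd r) b)
        - (\<Xi> a b - \<Xi> a (hd r) - \<Xi> (hd r) b) - (\<Xi> a (hd r) - \<Xi> a (last l) - \<Xi> (last l) (hd r))"
      by (simp add: p_eq partition_sum_append2[OF l r])
    have "norm (partition_sum \<Xi> p - \<Xi> a b) \<le> 2 * (K * ((b - a) / 2) powr \<theta>) + 2 * (C * (b - a) powr \<theta>)"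
      unfolding eq
      using norm_triangle_ineq4[of "(partition_sum \<Xi> l - \<Xi> a (last l)) + (partition_sum \<Xi> r - \<Xi> (hd r) b)
        - (\<Xi> a b - \<Xi> a (hd r) - \<Xi> (hd r) b)" "\<Xi> a (hd r) - \<Xi> a (last l) - \<Xi> (last l) (hd r)"]
        norm_triangle_ineq4[of "(partition_sum \<Xi> l - \<Xi> a (last l)) + (partition_sum \<Xi> r - \<Xi> (hd r) b)"
        "\<Xi> a b - \<Xi> a (hd r) - \<Xi> (hd r) b"]
        norm_triangle_ineq[of "partition_sum \<Xi> l - \<Xi> a (last l)" "partition_sum \<Xi> r - \<Xi> (hd r) b"]
        1 2 3 4 by linarith
    also have "\<dots> = (K * 2 powr (1 - \<theta>) + 2 * C) * (b - a) powr \<theta>"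
      using ab by (simp add: powr_divide powr_diff field_simps)
    finally show ?thesis by (simp add: K) (simp add: K_def)
  qed
qed

text \<open>Redefining the germ as 0 on the diagonal brings the preceding estimate into play.
  Partition sums do not change, because partition points increase strictly.\<close>

lemma sewing_bound:
  fixes \<Xi> :: "real \<Rightarrow> real \<Rightarrow> 'v::real_normed_vector"
  assumes "1 < \<theta>" "0 \<le> C"
    and "\<And>u m v. S \<le> u \<Longrightarrow> u < m \<Longrightarrow> m < v \<Longrightarrow> v \<le> E \<Longrightarrow>
      norm (\<Xi> u v - \<Xi> u m - \<Xi> m v) \<le> C * (v - u) powr \<theta>"
    and p: "partition_pts a b p" "S \<le> a" "b \<le> E" "a < b"
  shows "norm (partition_sum \<Xi> p - \<Xi> a b) \<le> 2 * C / (1 - 2 powr (1 - \<theta>)) * (b - a) powr \<theta>"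
proof -
  define \<Xi>0 where "\<Xi>0 u v = (if u = v then 0 else \<Xi> u v)" for u v
  have "partition_sum \<Xi> p = partition_sum \<Xi>0 p"
    by (rule partition_sum_cong) (use p in \<open>auto simp: partition_pts_def \<Xi>0_def\<close>)
  moreover have "norm (partition_sum \<Xi>0 p - \<Xi>0 a b) \<le> 2 * C / (1 - 2 powr (1 - \<theta>)) * (b - a) powr \<theta>"
    by (rule sewing_bound_aux[of \<theta> C \<Xi>0 S E]) (use assms in \<open>auto simp: \<Xi>0_def\<close>)
  ultimately show ?thesis using p by (simp add: \<Xi>0_def)
qed

text \<open>Inside each interval of p the finer q is again a partition, to which
  \<open>sewing_bound\<close> applies. The induction peels off the first interval of p, and the
  factors v - u add up to t - s.\<close>

lemma sewing_refinement_bound: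
  fixes \<Xi> :: "real \<Rightarrow> real \<Rightarrow> 'v::real_normed_vector"
  assumes \<theta>: "1 < \<theta>" and C: "0 \<le> C"
    and \<delta>: "\<And>u m v. S \<le> u \<Longrightarrow> u < m \<Longrightarrow> m < v \<Longrightarrow> v \<le> E \<Longrightarrow>
      norm (\<Xi> u v - \<Xi> u m - \<Xi> m v) \<le> C * (v - u) powr \<theta>"
    and pq: "partition_pts s t p" "partition_pts s t q" "set p \<subseteq> set q" "mesh_less p \<delta>"
      "S \<le> s" "t \<le> E"
  shows "norm (partition_sum \<Xi> q - partition_sum \<Xi> p)
    \<le> 2 * C / (1 - 2 powr (1 - \<theta>)) * \<delta> powr (\<theta> - 1) * (t - s)"
  using pq
proof (induction p arbitrary: s q rule: remdups_adj.induct)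
  case 1
  then show ?case by (simp add: partition_pts_def)
next
  case (2 a)
  then have st: "a = s" "t = s" by simp_all
  then have "q = [s]" using 2(2) by (simp add: partition_pts_refl)
  then show ?case by (simp add: st)
next
  case (3 a b p)
  define K where "K = 2 * C / (1 - 2 powr (1 - \<theta>))"
  have K: "0 \<le> K"
    using powr_less_mono[of "1 - \<theta>" 0 "2::real"] \<theta> C by (auto simp: K_def)
  have ab: "a = s" "s < b" "partition_pts b t (b # p)" using 3(3) by (auto simp: partition_pts_Cons2)
  have bt: "b \<le> t" using ab(3) partition_pts_set by blast
  obtain l r where q: "q = l @ b # r" using 3(5) split_list[of b q] by auto
  have pl: "partition_pts s b (l @ [b])" and pr: "partition_pts b t (b # r)"
    using partition_pts_append 3(4) q by auto
  have sub: "set (b # p) \<subseteq> set (b # r)"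
  proof
    fix z assume z: "z \<in> set (b # p)"
    then have "z \<in> set q" "b \<le> z" using 3(5) partition_pts_set(1)[OF ab(3)] by auto
    moreover have "z \<notin> set l" if "b \<le> z"
      using that 3(4) by (auto simp: q partition_pts_def sorted_wrt_append)
    ultimately show "z \<in> set (b # r)" by (auto simp: q)
  qed
  have "norm (partition_sum \<Xi> (l @ [b]) - \<Xi> s b) \<le> K * (b - s) powr \<theta>"
    unfolding K_def by (rule sewing_bound[OF \<theta> C \<delta> pl]) (use ab bt 3(7,8) in auto)
  also have "\<dots> \<le> K * ((b - s) * \<delta> powr (\<theta> - 1))"
    using ab 3(6) \<theta> by (intro mult_left_mono K powr_le_mult_powr) auto
  finally have A: "norm (partition_sum \<Xi> (l @ [b]) - \<Xi> s b) \<le> K * ((b - s) * \<delta> powr (\<theta> - 1))" .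
  have B: "norm (partition_sum \<Xi> (b # r) - partition_sum \<Xi> (b # p)) \<le> K * \<delta> powr (\<theta> - 1) * (t - b)"
  \<comment> \<open>The induction rule gives its hypothesis only for distinct leading entries;
    equality contradicts a < b.\<close>
  proof (cases "a = b")
    case False
    then show ?thesis unfolding K_def
      by (intro 3(2)) (use pr ab sub 3(6,7,8) in auto)
  qed (use ab in auto)
  have "partition_sum \<Xi> q - partition_sum \<Xi> (a # b # p) =
      (partition_sum \<Xi> (l @ [b]) - \<Xi> s b) + (partition_sum \<Xi> (b # r) - partition_sum \<Xi> (b # p))"
    using ab by (simp add: q partition_sum_append[of _ l b r])
  then have "norm (partition_sum \<Xi> q - partition_sum \<Xi> (a # b # p))
      \<le> norm (partition_sum \<Xi> (l @ [b]) - \<Xi> s b) + norm (partition_sum \<Xi> (b # r) - partition_sum \<Xi> (b # p))"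
    by (simp only: norm_triangle_ineq)
  also have "\<dots> \<le> K * \<delta> powr (\<theta> - 1) * (t - s)"
    using A B by (simp add: algebra_simps)
  finally show ?case by (simp add: K_def)
qed

lemma common_refinement:
  assumes "partition_pts s t p" "partition_pts s t q"
  shows "\<exists>r. partition_pts s t r \<and> set p \<subseteq> set r \<and> set q \<subseteq> set r"
proof (intro exI conjI)
  let ?r = "sorted_list_of_set (set p \<union> set q)"
  show r: "set p \<subseteq> set ?r" "set q \<subseteq> set ?r" by auto
  have st: "s \<in> set ?r" "t \<in> set ?r" "set ?r \<subseteq> {s..t}"
    using partition_pts_set[OF assms(1)] partition_pts_set[OF assms(2)] by auto
  have ne: "?r \<noteq> []" using st by force
  have srt: "sorted_wrt (<) ?r" by simp
  have "hd ?r = s"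
    using st ne srt by (cases ?r) force+
  moreover have "last ?r = t"
    using st ne srt by (cases ?r rule: rev_cases) (force simp: sorted_wrt_append)+
  ultimately show "partition_pts s t ?r" using ne srt by (simp add: partition_pts_def)
qed

lemma ex_small_powr:
  fixes c e \<theta> :: real
  assumes "1 < \<theta>" "0 \<le> c" "0 < e"
  shows "\<exists>\<delta>>0. c * \<delta> powr (\<theta> - 1) < e"
proof (intro exI conjI)
  \<comment> \<open>Inverts the power; c + 1 keeps the quotient defined for c = 0 and the final
    inequality strict.\<close>
  let ?\<delta> = "(e / (c + 1)) powr (1 / (\<theta> - 1))"
  show "0 < ?\<delta>" using assms by simp
  have "c * ?\<delta> powr (\<theta> - 1) = c * (e / (c + 1))" using assms by (simp add: powr_powr)
  also have "\<dots> < e" using assms by (simp add: field_simps)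
  finally show "c * ?\<delta> powr (\<theta> - 1) < e" .
qed

text \<open>Two partitions of small mesh are compared through a common refinement, which gives the
  Cauchy property. Completeness yields a limit along one sequence of partitions, and the same
  comparison shows that every fine partition is close to it.\<close>

lemma sewing_limit:
  fixes \<Xi> :: "real \<Rightarrow> real \<Rightarrow> 'v::banach"
  assumes \<theta>: "1 < \<theta>" and st: "s \<le> t"
    and \<delta>: "\<And>u m v. s \<le> u \<Longrightarrow> u < m \<Longrightarrow> m < v \<Longrightarrow> v \<le> t \<Longrightarrow>
      norm (\<Xi> u v - \<Xi> u m - \<Xi> m v) \<le> C * (v - u) powr \<theta>"
  shows "\<exists>I. (partition_sum \<Xi> \<longlongrightarrow> I) (partition_filter s t)"
proof -
  define K where "K = 2 * max C 0 / (1 - 2 powr (1 - \<theta>))"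
  \<comment> \<open>The factor 2 accounts for the two comparisons with the common
    refinement.\<close>
  define c where "c = 2 * (K * (t - s))"
  have c: "0 \<le> c"
    using powr_less_mono[of "1 - \<theta>" 0 "2::real"] \<theta> st by (auto simp: c_def K_def)
  \<comment> \<open>For s = t there is no triple u < m < v, and C may be negative.\<close>
  have \<delta>': "norm (\<Xi> u v - \<Xi> u m - \<Xi> m v) \<le> max C 0 * (v - u) powr \<theta>"
    if "s \<le> u" "u < m" "m < v" "v \<le> t" for u m v
    using \<delta>[OF that] by (rule order_trans) (intro mult_right_mono, auto)
  have close: "norm (partition_sum \<Xi> p - partition_sum \<Xi> q) \<le> c * d powr (\<theta> - 1)"
    if p: "partition_pts s t p" "mesh_less p d" and q: "partition_pts s t q" "mesh_less q d" for p q d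
  proof -
    obtain r where r: "partition_pts s t r" "set p \<subseteq> set r" "set q \<subseteq> set r"
      using common_refinement p q by blast
    have "norm (partition_sum \<Xi> r - partition_sum \<Xi> z) \<le> c / 2 * d powr (\<theta> - 1)"
      if "partition_pts s t z" "mesh_less z d" "set z \<subseteq> set r" for z
    proof -
      have "norm (partition_sum \<Xi> r - partition_sum \<Xi> z)
          \<le> K * d powr (\<theta> - 1) * (t - s)"
        unfolding K_def by (rule sewing_refinement_bound[where S = s and E = t]) (use \<theta> \<delta>' that r in auto)
      moreover have "\<dots> = c / 2 * d powr (\<theta> - 1)" by (simp add: c_def)
      ultimately show ?thesis by simp
    qed
    from this[of p] this[of q] p q r show ?thesis
      using norm_triangle_ineq4[of "partition_sum \<Xi> r - partition_sum \<Xi> q" "partition_sum \<Xi> r - partition_sum \<Xi> p"]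
      by simp
  qed
  have "\<forall>n. \<exists>p. partition_pts s t p \<and> mesh_less p (1 / Suc n)"
    using ex_partition_mesh_less[OF st] by simp
  then obtain P where P: "\<And>n. partition_pts s t (P n)" "\<And>n. mesh_less (P n) (1 / Suc n)"
    by metis
  have P_mesh: "mesh_less (P n) d" if "1 / Suc N < d" "N \<le> n" for n N d
    by (rule mesh_less_mono[OF P(2)]) (use that in \<open>smt (verit) frac_le of_nat_0_less_iff of_nat_mono zero_less_Suc Suc_le_mono\<close>)
  have "Cauchy (\<lambda>n. partition_sum \<Xi> (P n))"
  proof (rule CauchyI)
    fix e :: real assume "0 < e"
    then obtain d where d: "d > 0" "c * d powr (\<theta> - 1) < e" using ex_small_powr[OF \<theta> c] by blast
    obtain N where N: "1 / Suc N < d"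
      using reals_Archimedean[OF d(1)] by (auto simp: inverse_eq_divide)
    have "norm (partition_sum \<Xi> (P m) - partition_sum \<Xi> (P n)) < e" if "m \<ge> N" "n \<ge> N" for m n
      using close[of "P m" d "P n"] P(1) P_mesh N that d by force
    then show "\<exists>N. \<forall>m\<ge>N. \<forall>n\<ge>N. norm (partition_sum \<Xi> (P m) - partition_sum \<Xi> (P n)) < e"
      by blast
  qed
  then obtain I where I: "(\<lambda>n. partition_sum \<Xi> (P n)) \<longlonglongrightarrow> I"
    using Cauchy_convergent_iff convergent_def by blast
  have "(partition_sum \<Xi> \<longlongrightarrow> I) (partition_filter s t)"
  proof (rule tendstoI)
    fix e :: real assume "0 < e"
    then obtain d where d: "d > 0" "c * d powr (\<theta> - 1) < e" using ex_small_powr[OF \<theta> c] by blast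
    obtain N where N: "1 / Suc N < d"
      using reals_Archimedean[OF d(1)] by (auto simp: inverse_eq_divide)
    have "norm (partition_sum \<Xi> p - I) \<le> c * d powr (\<theta> - 1)"
      if "partition_pts s t p" "mesh_less p d" for p
    proof (rule LIMSEQ_le_const2)
      show "(\<lambda>n. norm (partition_sum \<Xi> p - partition_sum \<Xi> (P n))) \<longlonglongrightarrow> norm (partition_sum \<Xi> p - I)"
        by (intro tendsto_intros I)
      show "\<exists>N. \<forall>n\<ge>N. norm (partition_sum \<Xi> p - partition_sum \<Xi> (P n)) \<le> c * d powr (\<theta> - 1)"
        using close[OF that P(1)] P_mesh N by blast
    qed
    then show "\<forall>\<^sub>F p in partition_filter s t. dist (partition_sum \<Xi> p) I < e"
      unfolding eventually_partition_filter dist_norm using d by force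
  qed
  then show ?thesis ..
qed

section \<open>Negligible germs and the algebra of mesh limits\<close>

lemma partition_sum_small:
  fixes R :: "real \<Rightarrow> real \<Rightarrow> 'v::real_normed_vector"
  assumes \<theta>: "1 < \<theta>" and C: "0 \<le> C"
    and R: "\<And>u v. S \<le> u \<Longrightarrow> u < v \<Longrightarrow> v \<le> t \<Longrightarrow> norm (R u v) \<le> C * (v - u) powr \<theta>"
    and p: "partition_pts s t p" "mesh_less p \<delta>" "S \<le> s"
  shows "norm (partition_sum R p) \<le> C * \<delta> powr (\<theta> - 1) * (t - s)"
  using p
proof (induction p arbitrary: s rule: induct_list012)
  case (3 a b p)
  have ab: "a = s" "s < b" "partition_pts b t (b # p)" using 3(3) by (auto simp: partition_pts_Cons2)
  have bt: "b \<le> t" using ab(3) partition_pts_set by blast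
  have "norm (R s b) \<le> C * (b - s) powr \<theta>" using R ab bt 3 by auto
  also have "\<dots> \<le> C * ((b - s) * \<delta> powr (\<theta> - 1))"
    using ab 3 \<theta> by (intro mult_left_mono C powr_le_mult_powr) auto
  finally have "norm (R s b) \<le> C * ((b - s) * \<delta> powr (\<theta> - 1))" .
  moreover have "norm (partition_sum R (b # p)) \<le> C * \<delta> powr (\<theta> - 1) * (t - b)"
    using 3 ab by auto
  ultimately show ?case
    using ab norm_triangle_ineq[of "R s b" "partition_sum R (b # p)"] by (simp add: algebra_simps)
qed (auto simp: partition_pts_def)

text \<open>Consequently germs that differ by such an R have the same mesh limits.\<close>

lemma partition_sum_small_tendsto:
  fixes R :: "real \<Rightarrow> real \<Rightarrow> 'v::real_normed_vector"
  assumes \<theta>: "1 < \<theta>" and st: "s \<le> t"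
    and R: "\<And>u v. s \<le> u \<Longrightarrow> u < v \<Longrightarrow> v \<le> t \<Longrightarrow> norm (R u v) \<le> C * (v - u) powr \<theta>"
  shows "(partition_sum R \<longlongrightarrow> 0) (partition_filter s t)"
proof (rule tendstoI)
  fix e :: real assume e: "0 < e"
  have R': "norm (R u v) \<le> max C 0 * (v - u) powr \<theta>" if "s \<le> u" "u < v" "v \<le> t" for u v
    using R[OF that] by (rule order_trans) (intro mult_right_mono, auto)
  obtain d where d: "d > 0" "max C 0 * (t - s) * d powr (\<theta> - 1) < e"
    using ex_small_powr[OF \<theta> _ e, of "max C 0 * (t - s)"] st by auto
  have "norm (partition_sum R p) < e" if "partition_pts s t p" "mesh_less p d" for p
    using partition_sum_small[OF \<theta> _ R' that, of s] d by (simp add: mult_ac)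
  then show "\<forall>\<^sub>F p in partition_filter s t. dist (partition_sum R p) 0 < e"
    unfolding eventually_partition_filter dist_norm using d by force
qed

lemma has_mesh_limit_unique:
  assumes "has_mesh_limit \<Xi> s t I" "has_mesh_limit \<Xi> s t J"
  shows "I = J"
proof (cases "s \<le> t")
  case True
  then show ?thesis using assms tendsto_unique[OF partition_filter_nontrivial] by (force simp: has_mesh_limit_def)
next
  case False
  then have "- I = - J"
    using assms tendsto_unique[OF partition_filter_nontrivial[of t s]] by (force simp: has_mesh_limit_def)
  then show ?thesis by simp
qed

lemma has_mesh_limit_add:
  assumes "has_mesh_limit \<Xi> s t I" "has_mesh_limit \<Xi>' s t J"
  shows "has_mesh_limit (\<lambda>u v. \<Xi> u v + \<Xi>' u v) s t (I + J)"
proof -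
  have "partition_sum (\<lambda>u v. \<Xi> u v + \<Xi>' u v) = (\<lambda>p. partition_sum \<Xi> p + partition_sum \<Xi>' p)"
    by (auto simp: partition_sum_def case_prod_unfold sum_list_addf)
  then show ?thesis
    using assms tendsto_add[of "partition_sum \<Xi>" I _ "partition_sum \<Xi>'" J]
      tendsto_add[of "partition_sum \<Xi>" "- I" _ "partition_sum \<Xi>'" "- J"]
    by (auto simp: has_mesh_limit_def split: if_splits)
qed

lemma has_mesh_limit_0: "has_mesh_limit (\<lambda>u v. 0) s t 0"
  by (simp add: has_mesh_limit_def partition_sum_def[abs_def] case_prod_unfold)

lemma has_mesh_limit_sum:
  assumes "\<And>i. i \<in> A \<Longrightarrow> has_mesh_limit (\<Xi> i) s t (I i)"
  shows "has_mesh_limit (\<lambda>u v. \<Sum>i\<in>A. \<Xi> i u v) s t (\<Sum>i\<in>A. I i)"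
  using assms by (induction A rule: infinite_finite_induct) (auto intro: has_mesh_limit_add has_mesh_limit_0)

lemma partition_sum_telescope:
  "p \<noteq> [] \<Longrightarrow> partition_sum (\<lambda>u v. f v - f u) p = f (last p) - f (hd p)"
  by (induction p rule: induct_list012) auto

lemma has_mesh_limit_telescope: "has_mesh_limit (\<lambda>u v. f v - f u) s t (f t - f s)"
proof -
  have "(partition_sum (\<lambda>u v. f v - f u) \<longlongrightarrow> f t - f s) (partition_filter s t)" for s t
    by (rule tendsto_eventually, unfold eventually_partition_filter)
      (auto intro!: exI[of _ 1] simp: partition_pts_def partition_sum_telescope)
  then show ?thesis by (auto simp: has_mesh_limit_def)
qed

section \<open>Hoelder bounds\<close>

lemma hoelder_boundedI:
  assumes "\<And>s t. s \<in> {0..T} \<Longrightarrow> t \<in> {0..T} \<Longrightarrow> s \<noteq> t \<Longrightarrow> norm (A s t) \<le> C * \<bar>t - s\<bar> powr \<beta>"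
  shows "hoelder_bounded T \<beta> A"
  unfolding hoelder_bounded_def using assms by (intro exI[of _ C]) (auto simp: divide_le_eq)

lemma hoelder_boundedE:
  assumes "hoelder_bounded T \<beta> A"
  obtains C where "0 \<le> C" "\<And>s t. s \<in> {0..T} \<Longrightarrow> t \<in> {0..T} \<Longrightarrow> s \<noteq> t \<Longrightarrow> norm (A s t) \<le> C * \<bar>t - s\<bar> powr \<beta>"
proof -
  obtain C where C: "\<And>s t. s \<in> {0..T} \<Longrightarrow> t \<in> {0..T} \<Longrightarrow> s \<noteq> t \<Longrightarrow> norm (A s t) / \<bar>t - s\<bar> powr \<beta> \<le> C"
    using assms unfolding hoelder_bounded_def by blast
  have "norm (A s t) \<le> max C 0 * \<bar>t - s\<bar> powr \<beta>" if "s \<in> {0..T}" "t \<in> {0..T}" "s \<noteq> t" for s t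
    using C[OF that] that by (simp add: divide_le_eq) (smt (verit) mult_right_mono powr_ge_zero)
  then show ?thesis using that[of "max C 0"] by simp
qed

lemma hoelder_bounded_cong:
  assumes "\<And>s t. s \<in> {0..T} \<Longrightarrow> t \<in> {0..T} \<Longrightarrow> A s t = B s t"
  shows "hoelder_bounded T \<beta> A \<longleftrightarrow> hoelder_bounded T \<beta> B"
  using assms by (auto simp: hoelder_bounded_def)

lemma hoelder_bounded_0: "hoelder_bounded T \<beta> (\<lambda>s t. 0)"
  by (rule hoelder_boundedI[of _ _ 0]) auto

lemma hoelder_bounded_add:
  assumes "hoelder_bounded T \<beta> A" "hoelder_bounded T \<beta> B"
  shows "hoelder_bounded T \<beta> (\<lambda>s t. A s t + B s t)"
proof -
  obtain C D where C: "\<And>s t. s \<in> {0..T} \<Longrightarrow> t \<in> {0..T} \<Longrightarrow> s \<noteq> t \<Longrightarrow> norm (A s t) \<le> C * \<bar>t - s\<bar> powr \<beta>"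
    and D: "\<And>s t. s \<in> {0..T} \<Longrightarrow> t \<in> {0..T} \<Longrightarrow> s \<noteq> t \<Longrightarrow> norm (B s t) \<le> D * \<bar>t - s\<bar> powr \<beta>"
    using assms by (metis hoelder_boundedE)
  show ?thesis
  proof (rule hoelder_boundedI[of _ _ "C + D"])
    fix s t assume "s \<in> {0..T}" "t \<in> {0..T}" "s \<noteq> t"
    from C[OF this] D[OF this] show "norm (A s t + B s t) \<le> (C + D) * \<bar>t - s\<bar> powr \<beta>"
      unfolding distrib_right by (rule norm_triangle_mono)
  qed
qed

lemma hoelder_bounded_diff:
  assumes "hoelder_bounded T \<beta> A" "hoelder_bounded T \<beta> B"
  shows "hoelder_bounded T \<beta> (\<lambda>s t. A s t - B s t)"
  using hoelder_bounded_add[OF assms(1), of "\<lambda>s t. - B s t"] assms(2) by (simp add: hoelder_bounded_def)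

lemma hoelder_bounded_sum:
  assumes "\<And>i. i \<in> I \<Longrightarrow> hoelder_bounded T \<beta> (A i)"
  shows "hoelder_bounded T \<beta> (\<lambda>s t. \<Sum>i\<in>I. A i s t)"
  using assms
  by (induction I rule: infinite_finite_induct) (auto intro: hoelder_bounded_add hoelder_bounded_0)

lemma hoelder_bounded_scaleR:
  assumes "hoelder_bounded T \<beta> A" "hoelder_bounded T \<gamma> B"
  shows "hoelder_bounded T (\<beta> + \<gamma>) (\<lambda>s t. A s t *\<^sub>R B s t)"
proof -
  obtain C D where C: "0 \<le> C" "\<And>s t. s \<in> {0..T} \<Longrightarrow> t \<in> {0..T} \<Longrightarrow> s \<noteq> t \<Longrightarrow> norm (A s t) \<le> C * \<bar>t - s\<bar> powr \<beta>"
    and D: "0 \<le> D" "\<And>s t. s \<in> {0..T} \<Longrightarrow> t \<in> {0..T} \<Longrightarrow> s \<noteq> t \<Longrightarrow> norm (B s t) \<le> D * \<bar>t - s\<bar> powr \<gamma>"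
    using assms by (metis hoelder_boundedE)
  show ?thesis
  proof (rule hoelder_boundedI[of _ _ "C * D"])
    fix s t assume st: "s \<in> {0..T}" "t \<in> {0..T}" "s \<noteq> t"
    have "norm (A s t *\<^sub>R B s t) \<le> (C * \<bar>t - s\<bar> powr \<beta>) * (D * \<bar>t - s\<bar> powr \<gamma>)"
      using C D st by (simp, intro mult_mono) auto
    then show "norm (A s t *\<^sub>R B s t) \<le> C * D * \<bar>t - s\<bar> powr (\<beta> + \<gamma>)"
      by (simp add: powr_add mult_ac)
  qed
qed

text \<open>Exponent 0 stands for plain boundedness, so \<open>hoelder_bounded_scaleR\<close>
  absorbs bounded factors without loss of order.\<close>

lemma hoelder_bounded_const:
  assumes "\<And>s t. s \<in> {0..T} \<Longrightarrow> t \<in> {0..T} \<Longrightarrow> norm (A s t) \<le> M"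
  shows "hoelder_bounded T 0 A"
  using assms by (intro hoelder_boundedI[of _ _ M]) auto

section \<open>Rough and Young integrals\<close>

lemma sewing_has_mesh_limit:
  fixes \<Xi> :: "real \<Rightarrow> real \<Rightarrow> 'v::banach"
  assumes "1 < \<theta>" "s \<in> {0..T}" "t \<in> {0..T}"
    and \<delta>: "\<And>u m v. 0 \<le> u \<Longrightarrow> u < m \<Longrightarrow> m < v \<Longrightarrow> v \<le> T \<Longrightarrow>
      norm (\<Xi> u v - \<Xi> u m - \<Xi> m v) \<le> C * (v - u) powr \<theta>"
  shows "\<exists>I. has_mesh_limit \<Xi> s t I"
proof (cases "s \<le> t")
  case True
  have "\<exists>I. (partition_sum \<Xi> \<longlongrightarrow> I) (partition_filter s t)"
    by (rule sewing_limit[OF assms(1) True]) (rule \<delta>, use assms in auto)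
  then show ?thesis using True by (simp add: has_mesh_limit_def)
next
  case False
  then have "\<exists>I. (partition_sum \<Xi> \<longlongrightarrow> I) (partition_filter t s)"
    by (intro sewing_limit[OF assms(1)]) (simp, rule \<delta>, use assms in auto)
  then show ?thesis using False by (simp add: has_mesh_limit_def) (metis minus_minus)
qed

lemma mesh_limit_eq_increment:
  fixes f :: "real \<Rightarrow> 'v::real_normed_vector"
  assumes \<theta>: "1 < \<theta>" and st: "s \<in> {0..T}" "t \<in> {0..T}"
    and R: "hoelder_bounded T \<theta> (\<lambda>u v. f v - f u - \<Xi> u v)"
    and I: "has_mesh_limit \<Xi> s t I"
  shows "f t - f s = I"
proof -
  obtain C where C: "\<And>u v. u \<in> {0..T} \<Longrightarrow> v \<in> {0..T} \<Longrightarrow> u \<noteq> v \<Longrightarrow>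
      norm (f v - f u - \<Xi> u v) \<le> C * \<bar>v - u\<bar> powr \<theta>"
    using hoelder_boundedE[OF R] by metis
  have "(partition_sum (\<lambda>u v. f v - f u - \<Xi> u v) \<longlongrightarrow> 0) (partition_filter a b)"
    if "a \<le> b" "a \<in> {0..T}" "b \<in> {0..T}" for a b
  proof (rule partition_sum_small_tendsto[OF \<theta> that(1)])
    show "norm (f v - f u - \<Xi> u v) \<le> C * (v - u) powr \<theta>" if "a \<le> u" "u < v" "v \<le> b" for u v
      using C[of u v] that \<open>a \<in> {0..T}\<close> \<open>b \<in> {0..T}\<close> by auto
  qed
  then have "has_mesh_limit (\<lambda>u v. f v - f u - \<Xi> u v) s t 0"
    using st by (auto simp: has_mesh_limit_def)
  from has_mesh_limit_add[OF this I] have "has_mesh_limit (\<lambda>u v. f v - f u) s t I" by simp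
  then show ?thesis by (rule has_mesh_limit_unique[OF has_mesh_limit_telescope])
qed

lemma rough_integral_has_mesh_limit:
  assumes "rough_integrable \<alpha> X Y b s t"
  shows "has_mesh_limit (rough_sum_term \<alpha> X Y b) s t (rough_integral \<alpha> X Y b s t)"
proof -
  obtain I where "has_mesh_limit (rough_sum_term \<alpha> X Y b) s t I"
    using assms unfolding rough_integrable_def by blast
  from theI[of "has_mesh_limit _ s t", OF this has_mesh_limit_unique[OF _ this]] show ?thesis
    unfolding rough_integral_def .
qed

lemma young_integral_has_mesh_limit:
  assumes "young_integrable G H s t"
  shows "has_mesh_limit (young_sum_term G H) s t (young_integral G H s t)"
proof -
  obtain I where "has_mesh_limit (young_sum_term G H) s t I"
    using assms unfolding young_integrable_def by blast
  from theI[of "has_mesh_limit _ s t", OF this has_mesh_limit_unique[OF _ this]] show ?thesis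
    unfolding young_integral_def .
qed

text \<open>For left-point sums the additivity defect is minus an increment of H over [m, v] times
  an increment of G over [u, m], hence of order \<open>\<beta> + \<gamma> > 1\<close>.\<close>

lemma young_integrable_hoelder:
  fixes G :: "real \<Rightarrow> 'v::banach"
  assumes G: "hoelder_bounded T \<beta> (\<lambda>s t. G t - G s)" and H: "hoelder_bounded T \<gamma> (\<lambda>s t. H t - H s)"
    and \<beta>\<gamma>: "0 \<le> \<beta>" "0 \<le> \<gamma>" "1 < \<beta> + \<gamma>" and st: "s \<in> {0..T}" "t \<in> {0..T}"
  shows "young_integrable G H s t"
proof -
  obtain C where C: "0 \<le> C" "\<And>s t. s \<in> {0..T} \<Longrightarrow> t \<in> {0..T} \<Longrightarrow> s \<noteq> t \<Longrightarrow>
      norm (G t - G s) \<le> C * \<bar>t - s\<bar> powr \<beta>"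
    using hoelder_boundedE[OF G] by metis
  obtain D where D: "0 \<le> D" "\<And>s t. s \<in> {0..T} \<Longrightarrow> t \<in> {0..T} \<Longrightarrow> s \<noteq> t \<Longrightarrow>
      norm (H t - H s) \<le> D * \<bar>t - s\<bar> powr \<gamma>"
    using hoelder_boundedE[OF H] by metis
  have "norm (young_sum_term G H u v - young_sum_term G H u m - young_sum_term G H m v)
      \<le> (D * C) * (v - u) powr (\<beta> + \<gamma>)" if u: "0 \<le> u" "u < m" "m < v" "v \<le> T" for u m v
  proof -
    have eq: "young_sum_term G H u v - young_sum_term G H u m - young_sum_term G H m v
        = - ((H v - H m) *\<^sub>R (G m - G u))"
      by (simp add: young_sum_term_def algebra_simps)
    have "norm (H v - H m) * norm (G m - G u) \<le> (D * \<bar>v - m\<bar> powr \<gamma>) * (C * \<bar>m - u\<bar> powr \<beta>)"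
      by (intro mult_mono C D) (use u C D in auto)
    also have "\<dots> \<le> (D * (v - u) powr \<gamma>) * (C * (v - u) powr \<beta>)"
      by (intro mult_mono mult_left_mono powr_mono2) (use u C D \<beta>\<gamma> in auto)
    finally show ?thesis unfolding eq by (simp add: powr_add mult_ac)
  qed
  then show ?thesis unfolding young_integrable_def
    using \<beta>\<gamma> st by (intro sewing_has_mesh_limit[where T = T]) auto
qed

section \<open>Chen's relation for planted trees and existence of rough integrals\<close>

lemma tensor_mult_unit_left: "tensor_mult {#([], [])#} M = M"
  by (simp add: tensor_mult_def) (induction M, auto)

text \<open>Grafting onto a root is a Hochschild 1-cocycle for the coproduct: this is the recursion
  with empty \<omega>.\<close>

lemma coprod_bplus:
  "coprod (bplus b \<tau>) = {#(bplus b \<tau>, [])#} + image_mset (\<lambda>(\<sigma>, \<rho>). (\<sigma>, bplus b \<rho>)) (coprod \<tau>)"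
  using coprod.simps(2)[of "[]" b \<tau>] by (simp add: tensor_mult_unit_left)

lemma shuffle_mset_Nil_right [simp]: "shuffle_mset xs [] = {#xs#}"
  by (cases xs) auto

text \<open>A single last vertex brings an empty left factor into the product, so no nontrivial
  shuffle arises.\<close>

lemma coprod_snoc_bullet:
  "coprod (\<omega> @ bullet b) = {#(\<omega> @ bullet b, [])#} + image_mset (\<lambda>(\<sigma>, \<rho>). (\<sigma>, \<rho> @ bullet b)) (coprod \<omega>)"
proof -
  have "tensor_mult M {#([], bullet b)#} = image_mset (\<lambda>(\<sigma>, \<rho>). (\<sigma>, \<rho> @ bullet b)) M" for M
    by (simp add: tensor_mult_def) (induction M, auto)
  then show ?thesis using coprod.simps(2)[of \<omega> b "[]"] by simp
qed

lemma coprod_bullet: "coprod (bullet b) = {#(bullet b, []), ([], bullet b)#}"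
  using coprod_bplus[of b "[]"] by simp

text \<open>Keeps the right factors of a coproduct in the finite set over which
  \<open>star_bplus\<close> regroups its terms.\<close>

lemma fsize_coprod_right: "(\<sigma>, \<rho>) \<in># coprod \<tau> \<Longrightarrow> fsize \<rho> \<le> fsize \<tau>"
proof (induction \<tau> arbitrary: \<sigma> \<rho> rule: coprod.induct)
  case (2 \<omega> b \<tau>)
  then show ?case by (fastforce simp: tensor_mult_def intro: add_mono)
qed auto

text \<open>Collects terms by their second component. For \<open>M = coprod \<tau>\<close> the inner
  sum is \<open>star f (forest_vec r) \<tau>\<close>.\<close>

lemma sum_mset_group_snd:
  fixes f :: "'a \<Rightarrow> real"
  assumes "finite S" "\<And>a c. (a, c) \<in># M \<Longrightarrow> c \<in> S"
  shows "(\<Sum>(a, c)\<in>#M. f a * g c) = (\<Sum>r\<in>S. (\<Sum>(a, c)\<in>#M. f a * of_bool (c = r)) * g r)"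
  using assms(2)
proof (induction M)
  case (add p M)
  obtain a c where p: "p = (a, c)" by (cases p)
  have "(\<Sum>r\<in>S. f a * of_bool (c = r) * g r) = (\<Sum>r\<in>S. if c = r then f a * g r else 0)"
    by (intro sum.cong) auto
  also have "\<dots> = f a * g c" using add.prems[of a c] assms(1) p by (simp add: sum.delta')
  finally have "(\<Sum>r\<in>S. f a * of_bool (c = r) * g r) = f a * g c" .
  moreover have "(\<Sum>(a, c)\<in>#M. f a * g c) = (\<Sum>r\<in>S. (\<Sum>(a, c)\<in>#M. f a * of_bool (c = r)) * g r)"
    using add.prems by (intro add.IH) auto
  ultimately show ?case using p by (simp add: distrib_right sum.distrib)
qed simp

text \<open>The cocycle property, regrouped by right factors, produces exactly the coefficients
  \<open>star x (forest_vec \<rho>) \<tau>\<close> that occur in the definition of a controlled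
  path.\<close>

lemma star_bplus:
  fixes x y :: "'b::finite forest \<Rightarrow> real"
  assumes "fsize \<tau> \<le> m"
  shows "star x y (bplus b \<tau>) = x (bplus b \<tau>) * y [] +
    (\<Sum>\<rho>\<in>forests_upto m. star x (forest_vec \<rho>) \<tau> * y (bplus b \<rho>))"
proof -
  have "(\<Sum>(\<sigma>, \<rho>)\<in>#coprod \<tau>. x \<sigma> * y (bplus b \<rho>)) =
      (\<Sum>\<rho>\<in>forests_upto m. (\<Sum>(\<sigma>, \<rho>')\<in>#coprod \<tau>. x \<sigma> * of_bool (\<rho>' = \<rho>)) * y (bplus b \<rho>))"
  proof (rule sum_mset_group_snd[OF finite_forests_upto])
    fix \<sigma> \<rho> assume "(\<sigma>, \<rho>) \<in># coprod \<tau>"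
    from fsize_coprod_right[OF this] show "\<rho> \<in> forests_upto m"
      using assms by (simp add: forests_upto_def)
  qed
  then show ?thesis
    by (simp add: star_def coprod_bplus forest_vec_def image_mset.compositionality comp_def case_prod_unfold)
qed

lemma planar_rough_pathD:
  assumes "planar_rough_path \<alpha> T X"
  shows "0 < \<alpha>" "\<alpha> \<le> 1"
    and "\<And>s t. s \<in> {0..T} \<Longrightarrow> t \<in> {0..T} \<Longrightarrow> X s t [] = 1"
    and "\<And>s u t \<tau>. s \<in> {0..T} \<Longrightarrow> u \<in> {0..T} \<Longrightarrow> t \<in> {0..T} \<Longrightarrow> fsize \<tau> \<le> rp_order \<alpha> \<Longrightarrow>
      X s t \<tau> = star (X s u) (X u t) \<tau>"
    and "\<And>s t \<sigma> \<tau>. s \<in> {0..T} \<Longrightarrow> t \<in> {0..T} \<Longrightarrow> fsize \<sigma> + fsize \<tau> \<le> rp_order \<alpha> \<Longrightarrow>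
      (\<Sum>\<rho>\<in>#shuffle_mset \<sigma> \<tau>. X s t \<rho>) = X s t \<sigma> * X s t \<tau>"
    and "\<And>\<tau>. fsize \<tau> \<le> rp_order \<alpha> \<Longrightarrow> hoelder_bounded T (real (fsize \<tau>) * \<alpha>) (\<lambda>s t. X s t \<tau>)"
proof -
  show "X s t \<tau> = star (X s u) (X u t) \<tau>"
    if "s \<in> {0..T}" "u \<in> {0..T}" "t \<in> {0..T}" "fsize \<tau> \<le> rp_order \<alpha>" for s u t \<tau>
  proof -
    have "trunc (rp_order \<alpha>) (star (X s u) (X u t)) = X s t"
      using assms that unfolding planar_rough_path_def by blast
    from fun_cong[OF this, of \<tau>] show ?thesis using that by (simp add: trunc_def)
  qed
qed (use assms in \<open>simp_all add: planar_rough_path_def forests_upto_def\<close>)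

text \<open>N is the integer part of \<open>1 / \<alpha>\<close>, so \<open>(N + 1) \<alpha>\<close>
  exceeds 1 and can serve as sewing exponent.\<close>

lemma rp_order_bounds:
  assumes "0 < \<alpha>" "\<alpha> \<le> 1"
  shows "1 \<le> rp_order \<alpha>" "1 < (real (rp_order \<alpha>) + 1) * \<alpha>"
proof -
  have "1 \<le> 1 / \<alpha>" using assms by simp
  then have 1: "1 \<le> \<lfloor>1 / \<alpha>\<rfloor>" by (simp only: le_floor_iff of_int_1)
  then show "1 \<le> rp_order \<alpha>" unfolding rp_order_def by linarith
  have "real (rp_order \<alpha>) = of_int \<lfloor>1 / \<alpha>\<rfloor>" using 1 assms by (simp add: rp_order_def)
  then have "1 / \<alpha> < real (rp_order \<alpha>) + 1" by linarith
  then show "1 < (real (rp_order \<alpha>) + 1) * \<alpha>" using assms by (simp add: divide_less_eq)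
qed

text \<open>After Chen's relation and an exchange of the two sums, the coefficient of each planted
  tree over [u, t] is the remainder over [s, u] that controlledness bounds.\<close>

lemma rough_sum_term_increment:
  assumes X: "planar_rough_path \<alpha> T X" and u: "s \<in> {0..T}" "u \<in> {0..T}" "t \<in> {0..T}"
  shows "rough_sum_term \<alpha> X Y b s t - rough_sum_term \<alpha> X Y b s u - rough_sum_term \<alpha> X Y b u t
    = - (\<Sum>\<rho>\<in>forests_upto (rp_order \<alpha> - 1). X u t (bplus b \<rho>) *\<^sub>R
      (Y u \<rho> - (\<Sum>\<tau>\<in>forests_upto (rp_order \<alpha> - 1). star (X s u) (forest_vec \<rho>) \<tau> *\<^sub>R Y s \<tau>)))"
proof -
  let ?S = "forests_upto (rp_order \<alpha> - 1) :: 'a forest set"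
  have chen: "X s t (bplus b \<tau>) = X s u (bplus b \<tau>) +
      (\<Sum>\<rho>\<in>?S. star (X s u) (forest_vec \<rho>) \<tau> * X u t (bplus b \<rho>))" if "\<tau> \<in> ?S" for \<tau>
  proof -
    \<comment> \<open>As N is at least 1, the natural subtraction is exact, and planting a forest of
      at most N - 1 vertices stays within the truncation.\<close>
    have \<tau>: "fsize \<tau> \<le> rp_order \<alpha> - 1" "fsize (bplus b \<tau>) \<le> rp_order \<alpha>"
      using that rp_order_bounds(1) planar_rough_pathD(1,2)[OF X] by (fastforce simp: forests_upto_def)+
    show ?thesis
      using planar_rough_pathD(4)[OF X u \<tau>(2)] star_bplus[OF \<tau>(1)] planar_rough_pathD(3)[OF X u(2,3)] by simp
  qed
  have "rough_sum_term \<alpha> X Y b s t = rough_sum_term \<alpha> X Y b s u +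
      (\<Sum>\<tau>\<in>?S. \<Sum>\<rho>\<in>?S. (star (X s u) (forest_vec \<rho>) \<tau> * X u t (bplus b \<rho>)) *\<^sub>R Y s \<tau>)"
    unfolding rough_sum_term_def by (simp add: chen scaleR_add_left sum.distrib scaleR_sum_left)
  also have "(\<Sum>\<tau>\<in>?S. \<Sum>\<rho>\<in>?S. (star (X s u) (forest_vec \<rho>) \<tau> * X u t (bplus b \<rho>)) *\<^sub>R Y s \<tau>)
      = (\<Sum>\<rho>\<in>?S. X u t (bplus b \<rho>) *\<^sub>R (\<Sum>\<tau>\<in>?S. star (X s u) (forest_vec \<rho>) \<tau> *\<^sub>R Y s \<tau>))"
    by (subst sum.swap) (simp add: scaleR_sum_right mult.commute)
  finally show ?thesis
    unfolding rough_sum_term_def[of _ _ _ _ u t] by (simp add: scaleR_diff_right sum_subtractf)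
qed

text \<open>In each term of the defect the exponents \<open>(|\<rho>| + 1) \<alpha>\<close> of the
  tree and \<open>(N - |\<rho>|) \<alpha>\<close> of the remainder add up to
  \<open>(N + 1) \<alpha> > 1\<close>.\<close>

lemma rough_integrable_controlled:
  fixes Y :: "real \<Rightarrow> 'b::finite forest \<Rightarrow> 'v::banach"
  assumes X: "planar_rough_path \<alpha> T X" and Y: "controlled_path \<alpha> T X Y"
    and st: "s \<in> {0..T}" "t \<in> {0..T}"
  shows "rough_integrable \<alpha> X Y b s t"
proof -
  let ?N = "rp_order \<alpha>"
  let ?S = "forests_upto (?N - 1) :: 'b forest set"
  define R where "R \<rho> s u = Y u \<rho> - (\<Sum>\<tau>\<in>?S. star (X s u) (forest_vec \<rho>) \<tau> *\<^sub>R Y s \<tau>)" for \<rho> s u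
  have \<alpha>: "0 < \<alpha>" "\<alpha> \<le> 1" using planar_rough_pathD[OF X] by blast+
  note N = rp_order_bounds[OF \<alpha>]
  have size: "fsize \<rho> \<le> ?N - 1" if "\<rho> \<in> ?S" for \<rho>
    using that by (simp add: forests_upto_def)
  have "\<forall>\<rho>\<in>?S. \<exists>C\<ge>0. \<forall>s\<in>{0..T}. \<forall>t\<in>{0..T}. s \<noteq> t \<longrightarrow>
      norm (X s t (bplus b \<rho>)) \<le> C * \<bar>t - s\<bar> powr ((real (fsize \<rho>) + 1) * \<alpha>)"
  proof
    fix \<rho> assume "\<rho> \<in> ?S"
    then have "hoelder_bounded T (real (fsize (bplus b \<rho>)) * \<alpha>) (\<lambda>s t. X s t (bplus b \<rho>))"
      using size N by (intro planar_rough_pathD(6)[OF X]) fastforce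
    then show "\<exists>C\<ge>0. \<forall>s\<in>{0..T}. \<forall>t\<in>{0..T}. s \<noteq> t \<longrightarrow>
        norm (X s t (bplus b \<rho>)) \<le> C * \<bar>t - s\<bar> powr ((real (fsize \<rho>) + 1) * \<alpha>)"
      by (elim hoelder_boundedE) (auto simp: add.commute)
  qed
  then obtain C where C: "\<And>\<rho>. \<rho> \<in> ?S \<Longrightarrow> 0 \<le> C \<rho>"
    "\<And>\<rho> s t. \<rho> \<in> ?S \<Longrightarrow> s \<in> {0..T} \<Longrightarrow> t \<in> {0..T} \<Longrightarrow> s \<noteq> t \<Longrightarrow>
      norm (X s t (bplus b \<rho>)) \<le> C \<rho> * \<bar>t - s\<bar> powr ((real (fsize \<rho>) + 1) * \<alpha>)"
    by metis
  have "\<forall>\<rho>\<in>?S. \<exists>D\<ge>0. \<forall>s\<in>{0..T}. \<forall>t\<in>{0..T}. s \<noteq> t \<longrightarrow>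
      norm (R \<rho> s t) \<le> D * \<bar>t - s\<bar> powr ((real ?N - real (fsize \<rho>)) * \<alpha>)"
  proof
    fix \<rho> assume "\<rho> \<in> ?S"
    then have "hoelder_bounded T ((real ?N - real (fsize \<rho>)) * \<alpha>) (R \<rho>)"
      using Y unfolding controlled_path_def R_def by blast
    then show "\<exists>D\<ge>0. \<forall>s\<in>{0..T}. \<forall>t\<in>{0..T}. s \<noteq> t \<longrightarrow>
        norm (R \<rho> s t) \<le> D * \<bar>t - s\<bar> powr ((real ?N - real (fsize \<rho>)) * \<alpha>)"
      by (elim hoelder_boundedE) auto
  qed
  then obtain D where D: "\<And>\<rho>. \<rho> \<in> ?S \<Longrightarrow> 0 \<le> D \<rho>"
    "\<And>\<rho> s t. \<rho> \<in> ?S \<Longrightarrow> s \<in> {0..T} \<Longrightarrow> t \<in> {0..T} \<Longrightarrow> s \<noteq> t \<Longrightarrow>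
      norm (R \<rho> s t) \<le> D \<rho> * \<bar>t - s\<bar> powr ((real ?N - real (fsize \<rho>)) * \<alpha>)"
    by metis
  let ?\<Xi> = "rough_sum_term \<alpha> X Y b"
  have "norm (?\<Xi> u v - ?\<Xi> u m - ?\<Xi> m v) \<le> (\<Sum>\<rho>\<in>?S. C \<rho> * D \<rho>) * (v - u) powr ((real ?N + 1) * \<alpha>)"
    if u: "0 \<le> u" "u < m" "m < v" "v \<le> T" for u m v
  proof -
    have eq: "?\<Xi> u v - ?\<Xi> u m - ?\<Xi> m v = - (\<Sum>\<rho>\<in>?S. X m v (bplus b \<rho>) *\<^sub>R R \<rho> u m)"
      unfolding R_def by (rule rough_sum_term_increment[OF X]) (use u in auto)
    have "norm (?\<Xi> u v - ?\<Xi> u m - ?\<Xi> m v) \<le> (\<Sum>\<rho>\<in>?S. norm (X m v (bplus b \<rho>) *\<^sub>R R \<rho> u m))"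
      unfolding eq norm_minus_cancel by (rule norm_sum)
    also have "\<dots> \<le> (\<Sum>\<rho>\<in>?S. C \<rho> * D \<rho> * (v - u) powr ((real ?N + 1) * \<alpha>))"
    proof (rule sum_mono)
      fix \<rho> assume \<rho>: "\<rho> \<in> ?S"
      \<comment> \<open>Makes \<open>(N - |\<rho>|) \<alpha>\<close> nonnegative, as monotonicity of
        \<open>powr\<close> in its base requires.\<close>
      have "real (fsize \<rho>) \<le> real ?N" using size[OF \<rho>] by simp
      have "norm (X m v (bplus b \<rho>) *\<^sub>R R \<rho> u m) \<le>
          (C \<rho> * \<bar>v - m\<bar> powr ((real (fsize \<rho>) + 1) * \<alpha>)) * (D \<rho> * \<bar>m - u\<bar> powr ((real ?N - real (fsize \<rho>)) * \<alpha>))"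
        using mult_mono[OF C(2)[OF \<rho>, of m v] D(2)[OF \<rho>, of u m]] u C(1)[OF \<rho>] by simp
      also have "\<dots> \<le>
          (C \<rho> * (v - u) powr ((real (fsize \<rho>) + 1) * \<alpha>)) * (D \<rho> * (v - u) powr ((real ?N - real (fsize \<rho>)) * \<alpha>))"
        by (intro mult_mono mult_left_mono powr_mono2)
          (use u C D \<rho> \<alpha> \<open>real (fsize \<rho>) \<le> real ?N\<close> in auto)
      also have "\<dots> = C \<rho> * D \<rho> * (v - u) powr ((real (fsize \<rho>) + 1) * \<alpha> + (real ?N - real (fsize \<rho>)) * \<alpha>)"
        by (simp add: powr_add mult_ac)
      also have "(real (fsize \<rho>) + 1) * \<alpha> + (real ?N - real (fsize \<rho>)) * \<alpha> = (real ?N + 1) * \<alpha>"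
        by (simp add: algebra_simps)
      finally show "norm (X m v (bplus b \<rho>) *\<^sub>R R \<rho> u m) \<le> C \<rho> * D \<rho> * (v - u) powr ((real ?N + 1) * \<alpha>)" .
    qed
    finally show ?thesis by (simp add: sum_distrib_right)
  qed
  then show ?thesis unfolding rough_integrable_def
    using st N by (intro sewing_has_mesh_limit[where T = T]) auto
qed

section \<open>Controlled lifts of smooth functions\<close>

lemma hoelder_bounded_vec:
  fixes x :: "real \<Rightarrow> real^'d::finite"
  assumes "\<And>k. hoelder_bounded T \<beta> (\<lambda>s t. x t $ k - x s $ k)"
  shows "hoelder_bounded T \<beta> (\<lambda>s t. x t - x s)"
proof -
  have "hoelder_bounded T (\<beta> + 0) (\<lambda>s t. (x t $ k - x s $ k) *\<^sub>R (axis k 1 :: real^'d))" for k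
    by (intro hoelder_bounded_scaleR assms hoelder_bounded_const[of _ _ 1]) simp
  then have "hoelder_bounded T \<beta> (\<lambda>s t. \<Sum>k\<in>UNIV. (x t $ k - x s $ k) *\<^sub>R (axis k 1 :: real^'d))"
    by (intro hoelder_bounded_sum) simp
  moreover have "(\<Sum>k\<in>UNIV. (x t $ k - x s $ k) *\<^sub>R (axis k 1 :: real^'d)) = x t - x s" for s t
    using basis_expansion[of "x t - x s"] by (simp add: scalar_mult_eq_scaleR)
  ultimately show ?thesis by simp
qed

text \<open>Provides a compact convex set containing the path, on which the constants of the Taylor
  bound are uniform.\<close>

lemma hoelder_path_in_cball:
  fixes x :: "real \<Rightarrow> 'v::real_normed_vector"
  assumes x: "hoelder_bounded T \<beta> (\<lambda>s t. x t - x s)" and \<beta>: "0 \<le> \<beta>"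
  shows "\<exists>R. \<forall>t\<in>{0..T}. x t \<in> cball (x 0) R"
proof -
  obtain C where C: "0 \<le> C" "\<And>s t. s \<in> {0..T} \<Longrightarrow> t \<in> {0..T} \<Longrightarrow> s \<noteq> t \<Longrightarrow>
      norm (x t - x s) \<le> C * \<bar>t - s\<bar> powr \<beta>"
    using hoelder_boundedE[OF x] by metis
  have "dist (x 0) (x t) \<le> C * T powr \<beta>" if t: "t \<in> {0..T}" for t
  proof (cases "t = 0")
    case False
    have "norm (x t - x 0) \<le> C * \<bar>t - 0\<bar> powr \<beta>" using C(2)[of 0 t] t False by auto
    also have "\<dots> \<le> C * T powr \<beta>" using t C \<beta> by (intro mult_left_mono powr_mono2) auto
    finally show ?thesis by (simp add: dist_norm norm_minus_commute)
  qed (use C in auto)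
  then show ?thesis by (intro exI[of _ "C * T powr \<beta>"]) simp
qed

lemma hoelder_bounded_path:
  fixes G :: "real^'d::finite \<Rightarrow> 'v::real_normed_vector"
  assumes "smooth G" "hoelder_bounded T \<beta> (\<lambda>s t. x t - x s)" "0 \<le> \<beta>"
  shows "hoelder_bounded T 0 (\<lambda>s t. G (x s))"
proof -
  obtain R where R: "\<And>t. t \<in> {0..T} \<Longrightarrow> x t \<in> cball (x 0) R"
    using hoelder_path_in_cball[OF assms(2,3)] by blast
  have "bounded (G ` cball (x 0) R)"
    by (intro compact_imp_bounded compact_continuous_image smooth_continuous_on assms compact_cball)
  then obtain M where "\<And>y. y \<in> cball (x 0) R \<Longrightarrow> norm (G y) \<le> M" unfolding bounded_iff by blast
  then show ?thesis using R by (intro hoelder_bounded_const[of _ _ M]) auto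
qed

lemma taylor_hoelder:
  fixes G :: "real^'d::finite \<Rightarrow> 'v::real_inner"
  assumes "smooth G" and x: "hoelder_bounded T \<beta> (\<lambda>s t. x t - x s)" "0 \<le> \<beta>" and n: "0 < n"
  shows "hoelder_bounded T (real n * \<beta>) (\<lambda>s t. G (x t) -
    (\<Sum>m<n. (1 / fact m) *\<^sub>R iterated_dir_deriv m G (x t - x s) (x s)))"
proof -
  obtain R where R: "\<And>t. t \<in> {0..T} \<Longrightarrow> x t \<in> cball (x 0) R"
    using hoelder_path_in_cball[OF x] by blast
  obtain C where C: "0 \<le> C" "\<And>s t. s \<in> {0..T} \<Longrightarrow> t \<in> {0..T} \<Longrightarrow> s \<noteq> t \<Longrightarrow>
      norm (x t - x s) \<le> C * \<bar>t - s\<bar> powr \<beta>"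
    using hoelder_boundedE[OF x(1)] by metis
  obtain M where M: "0 \<le> M" "\<forall>y\<in>cball (x 0) R. \<forall>z\<in>cball (x 0) R.
      norm (G z - (\<Sum>m<n. (1 / fact m) *\<^sub>R iterated_dir_deriv m G (z - y) y)) \<le> M * norm (z - y) ^ n"
    using taylor_bound[OF assms(1) compact_cball convex_cball n] by blast
  show ?thesis
  proof (rule hoelder_boundedI[of _ _ "M * C ^ n"])
    fix s t assume st: "s \<in> {0..T}" "t \<in> {0..T}" "s \<noteq> t"
    have "norm (G (x t) - (\<Sum>m<n. (1 / fact m) *\<^sub>R iterated_dir_deriv m G (x t - x s) (x s)))
        \<le> M * norm (x t - x s) ^ n"
      using M(2) R st by blast
    also have "\<dots> \<le> M * (C * \<bar>t - s\<bar> powr \<beta>) ^ n"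
      using M(1) C(2)[OF st] by (intro mult_left_mono power_mono) auto
    also have "\<dots> = M * C ^ n * \<bar>t - s\<bar> powr (real n * \<beta>)"
      using st by (simp add: power_mult_distrib powr_power mult.commute)
    finally show "norm (G (x t) - (\<Sum>m<n. (1 / fact m) *\<^sub>R iterated_dir_deriv m G (x t - x s) (x s)))
        \<le> M * C ^ n * \<bar>t - s\<bar> powr (real n * \<beta>)" .
  qed
qed

section \<open>Symmetrisation and shuffle relations\<close>

lemma sum_symmetric2:
  fixes D :: "'i::finite \<Rightarrow> 'i \<Rightarrow> 'v::real_vector"
  assumes D: "\<And>i j. D i j = D j i" and h: "\<And>i j. h i * h j = P i j + P j i"
  shows "(\<Sum>i\<in>UNIV. \<Sum>j\<in>UNIV. (h i * h j) *\<^sub>R D i j) = 2 *\<^sub>R (\<Sum>i\<in>UNIV. \<Sum>j\<in>UNIV. P i j *\<^sub>R D i j)"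
proof -
  have "(\<Sum>i\<in>UNIV. \<Sum>j\<in>UNIV. P j i *\<^sub>R D i j) = (\<Sum>i\<in>UNIV. \<Sum>j\<in>UNIV. P i j *\<^sub>R D i j)"
    by (subst sum.swap) (simp add: D)
  then show ?thesis by (simp add: h scaleR_add_left sum.distrib scaleR_2)
qed

text \<open>The adjacent transpositions \<open>S1\<close> and \<open>S2\<close> generate all
  permutations of three indices, so the six orderings of P have equal sums against the symmetric
  D.\<close>

lemma sum_symmetric3:
  fixes D :: "'i::finite \<Rightarrow> 'i \<Rightarrow> 'i \<Rightarrow> 'v::real_vector"
  assumes D: "\<And>i j k. D i j k = D j i k" "\<And>i j k. D i j k = D i k j"
    and h: "\<And>i j k. h i * h j * h k = P i j k + P i k j + P j i k + P j k i + P k i j + P k j i"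
  shows "(\<Sum>i\<in>UNIV. \<Sum>j\<in>UNIV. \<Sum>k\<in>UNIV. (h i * h j * h k) *\<^sub>R D i j k) =
    6 *\<^sub>R (\<Sum>i\<in>UNIV. \<Sum>j\<in>UNIV. \<Sum>k\<in>UNIV. P i j k *\<^sub>R D i j k)"
proof -
  define S where "S Q = (\<Sum>i\<in>UNIV. \<Sum>j\<in>UNIV. \<Sum>k\<in>UNIV. Q i j k *\<^sub>R D i j k)" for Q
  have S1: "S (\<lambda>i j k. Q j i k) = S Q" for Q
    unfolding S_def by (rule trans[OF sum.swap]) (simp add: D(1))
  have S2: "S (\<lambda>i j k. Q i k j) = S Q" for Q
    unfolding S_def by (rule sum.cong[OF refl], rule trans[OF sum.swap]) (simp add: D(2))
  have add: "S (\<lambda>i j k. Q i j k + Q' i j k) = S Q + S Q'" for Q Q'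
    unfolding S_def by (simp add: scaleR_add_left sum.distrib)
  have "S (\<lambda>i j k. h i * h j * h k) = S P + S P + S P + S P + S P + S P"
    unfolding h add
    using S1[of P] S2[of P] S2[of "\<lambda>i j k. P j i k"] S1[of "\<lambda>i j k. P i k j"] S1[of "\<lambda>i j k. P k i j"]
    by simp
  also have "\<dots> = (1 + 1 + 1 + 1 + 1 + 1) *\<^sub>R S P"
    by (simp only: scaleR_add_left scaleR_one)
  finally have "S (\<lambda>i j k. h i * h j * h k) = 6 *\<^sub>R S P" by simp
  then show ?thesis by (simp add: S_def)
qed

text \<open>Coefficients of a lift live on words of at most two single vertices with letters in the
  range of e; the finite sum over forests reduces to these.\<close>

lemma sum_forests_upto_2:
  fixes Y :: "'b::finite forest \<Rightarrow> 'v::real_vector" and e :: "'d::finite \<Rightarrow> 'b"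
  assumes e: "inj e"
    and Y: "\<And>\<tau>. \<tau> \<noteq> [] \<Longrightarrow> (\<And>k. \<tau> \<noteq> bullet (e k)) \<Longrightarrow>
      (\<And>k l. \<tau> \<noteq> bullet (e k) @ bullet (e l)) \<Longrightarrow> Y \<tau> = 0"
  shows "(\<Sum>\<tau>\<in>forests_upto 2. c \<tau> *\<^sub>R Y \<tau>) = c [] *\<^sub>R Y [] +
    (\<Sum>k\<in>UNIV. c (bullet (e k)) *\<^sub>R Y (bullet (e k))) +
    (\<Sum>k\<in>UNIV. \<Sum>l\<in>UNIV. c (bullet (e k) @ bullet (e l)) *\<^sub>R Y (bullet (e k) @ bullet (e l)))"
proof -
  let ?f = "\<lambda>\<tau>. c \<tau> *\<^sub>R Y \<tau>"
  let ?A = "(\<lambda>k. bullet (e k)) ` UNIV" and ?B = "(\<lambda>(k, l). bullet (e k) @ bullet (e l)) ` (UNIV \<times> UNIV)"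
  have "sum ?f (forests_upto 2) = sum ?f (insert [] (?A \<union> ?B))"
  proof (rule sum.mono_neutral_right)
    show "insert [] (?A \<union> ?B) \<subseteq> forests_upto 2" by (auto simp: forests_upto_def)
    show "\<forall>\<tau>\<in>forests_upto 2 - insert [] (?A \<union> ?B). c \<tau> *\<^sub>R Y \<tau> = 0"
    proof
      fix \<tau> assume \<tau>: "\<tau> \<in> forests_upto 2 - insert [] (?A \<union> ?B)"
      have "Y \<tau> = 0"
      proof (rule Y)
        show "\<tau> \<noteq> bullet (e k)" for k using \<tau> by blast
        show "\<tau> \<noteq> bullet (e k) @ bullet (e l)" for k l
          using \<tau> by (force intro: image_eqI[of _ _ "(k, l)"])
      qed (use \<tau> in blast)
      then show "c \<tau> *\<^sub>R Y \<tau> = 0" by simp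
    qed
  qed simp
  also have "\<dots> = ?f [] + (sum ?f ?A + sum ?f ?B)"
    by (subst sum.insert) (auto intro!: sum.union_disjoint)
  also have "sum ?f ?A = (\<Sum>k\<in>UNIV. ?f (bullet (e k)))"
    by (subst sum.reindex) (use e in \<open>auto simp: inj_def\<close>)
  also have "sum ?f ?B = (\<Sum>k\<in>UNIV. \<Sum>l\<in>UNIV. ?f (bullet (e k) @ bullet (e l)))"
    by (subst sum.reindex) (use e in \<open>auto simp: inj_on_def inj_def sum.cartesian_product case_prod_unfold\<close>)
  finally show ?thesis by (simp add: add.assoc)
qed

text \<open>For three letters, b and c are shuffled first and a is then shuffled into both resulting
  words; this gives each of the six orderings once.\<close>

lemma rough_path_bullets:
  assumes X: "planar_rough_path \<alpha> T X" and N: "rp_order \<alpha> = 3" and st: "s \<in> {0..T}" "t \<in> {0..T}"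
  defines "P \<equiv> X s t"
  shows "P (bullet a) * P (bullet b) = P (bullet a @ bullet b) + P (bullet b @ bullet a)"
    and "P (bullet a) * P (bullet b) * P (bullet c) =
      P (bullet a @ bullet b @ bullet c) + P (bullet a @ bullet c @ bullet b) +
      P (bullet b @ bullet a @ bullet c) + P (bullet b @ bullet c @ bullet a) +
      P (bullet c @ bullet a @ bullet b) + P (bullet c @ bullet b @ bullet a)"
proof -
  have 1: "P (bullet a) * P (bullet b) = P (bullet a @ bullet b) + P (bullet b @ bullet a)" for a b
    using planar_rough_pathD(5)[OF X st, of "bullet a" "bullet b"] N by (simp add: P_def)
  have 2: "P (bullet a) * P (bullet b @ bullet c) =
      P (bullet a @ bullet b @ bullet c) + P (bullet b @ bullet a @ bullet c) + P (bullet b @ bullet c @ bullet a)" for a b c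
    using planar_rough_pathD(5)[OF X st, of "bullet a" "bullet b @ bullet c"] N by (simp add: P_def)
  show "P (bullet a) * P (bullet b) = P (bullet a @ bullet b) + P (bullet b @ bullet a)" by (rule 1)
  have "P (bullet a) * P (bullet b) * P (bullet c) = P (bullet a) * P (bullet b @ bullet c) + P (bullet a) * P (bullet c @ bullet b)"
    using 1[of b c] by (simp add: algebra_simps)
  then show "P (bullet a) * P (bullet b) * P (bullet c) =
      P (bullet a @ bullet b @ bullet c) + P (bullet a @ bullet c @ bullet b) +
      P (bullet b @ bullet a @ bullet c) + P (bullet b @ bullet c @ bullet a) +
      P (bullet c @ bullet a @ bullet b) + P (bullet c @ bullet b @ bullet a)"
    unfolding 2 by simp
qed

text \<open>P may be any array whose symmetrisation is the product of coordinates: the controlled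
  lift uses two-letter words in the order i j, the Ito formula in the order j i.\<close>

lemma iterated_dir_deriv_2:
  fixes G :: "real^'d::finite \<Rightarrow> 'v::real_inner"
  assumes G: "smooth G" and P: "\<And>i j. h $ i * h $ j = P i j + P j i"
  shows "iterated_dir_deriv 2 G h z =
    2 *\<^sub>R (\<Sum>i\<in>UNIV. \<Sum>j\<in>UNIV. P i j *\<^sub>R partial_deriv i (partial_deriv j G) z)"
proof -
  have "iterated_dir_deriv 2 G h z =
      (\<Sum>i\<in>UNIV. \<Sum>j\<in>UNIV. (h $ i * h $ j) *\<^sub>R partial_deriv i (partial_deriv j G) z)"
    by (simp add: numeral_2_eq_2 scaleR_sum_right partial_deriv_commute[OF G])
  then show ?thesis
    using sum_symmetric2[of "\<lambda>i j. partial_deriv i (partial_deriv j G) z" "\<lambda>i. h $ i" P,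
      OF partial_deriv_commute[OF G] P] by simp
qed

lemma iterated_dir_deriv_3:
  fixes G :: "real^'d::finite \<Rightarrow> 'v::real_inner"
  assumes G: "smooth G"
    and P: "\<And>i j k. h $ i * h $ j * h $ k = P i j k + P i k j + P j i k + P j k i + P k i j + P k j i"
  shows "iterated_dir_deriv 3 G h z =
    6 *\<^sub>R (\<Sum>i\<in>UNIV. \<Sum>j\<in>UNIV. \<Sum>k\<in>UNIV. P i j k *\<^sub>R partial_deriv i (partial_deriv j (partial_deriv k G)) z)"
proof -
  let ?D = "\<lambda>i j k. partial_deriv i (partial_deriv j (partial_deriv k G)) z"
  have s1: "?D i j k = ?D j i k" for i j k by (rule partial_deriv_commute[OF smooth_partial_deriv[OF G]])
  have s2: "?D i j k = ?D i k j" for i j k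
    using partial_deriv_commute[OF G] by (metis ext)
  \<comment> \<open>The recursion of \<open>iterated_dir_deriv\<close> nests the derivatives in
    reverse order; this permutation restores it.\<close>
  have s3: "?D i j k = ?D k j i" for i j k using s1 s2 by metis
  have "iterated_dir_deriv 3 G h z = (\<Sum>i\<in>UNIV. \<Sum>j\<in>UNIV. \<Sum>k\<in>UNIV. (h $ i * h $ j * h $ k) *\<^sub>R ?D k j i)"
    by (simp add: numeral_3_eq_3 scaleR_sum_right mult.assoc)
  also have "\<dots> = (\<Sum>i\<in>UNIV. \<Sum>j\<in>UNIV. \<Sum>k\<in>UNIV. (h $ i * h $ j * h $ k) *\<^sub>R ?D i j k)"
    by (intro sum.cong refl) (metis s3)
  also have "\<dots> = 6 *\<^sub>R (\<Sum>i\<in>UNIV. \<Sum>j\<in>UNIV. \<Sum>k\<in>UNIV. P i j k *\<^sub>R ?D i j k)"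
    by (rule sum_symmetric3[OF s1 s2 P])
  finally show ?thesis .
qed

text \<open>On words of single vertices the coproduct is deconcatenation: \<tau> must be a suffix,
  and x is evaluated on the remaining prefix.\<close>

lemma star_forest_vec:
  "star x (forest_vec \<tau>) [] = x [] * of_bool ([] = \<tau>)"
  "star x (forest_vec \<tau>) (bullet a) = x (bullet a) * of_bool ([] = \<tau>) + x [] * of_bool (bullet a = \<tau>)"
  "star x (forest_vec \<tau>) (bullet a @ bullet b) = x (bullet a @ bullet b) * of_bool ([] = \<tau>) +
     x (bullet a) * of_bool (bullet b = \<tau>) + x [] * of_bool (bullet a @ bullet b = \<tau>)"
  by (simp_all only: star_def forest_vec_def coprod.simps(1) coprod_bullet coprod_two_bullets) simp_all

text \<open>The identity and \<open>Inl\<close> as \<open>e\<close> cover \<open>X\<close> and its bracket extension at once.\<close>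

lemma controlled_path_lift:
  fixes X :: "real \<Rightarrow> real \<Rightarrow> 'b::finite forest \<Rightarrow> real" and e :: "'d::finite \<Rightarrow> 'b"
    and G :: "real^'d \<Rightarrow> 'v::real_inner"
  assumes X: "planar_rough_path \<alpha> T X" and N: "rp_order \<alpha> = 3" and e: "inj e"
    and x: "\<And>s t k. s \<in> {0..T} \<Longrightarrow> t \<in> {0..T} \<Longrightarrow> X s t (bullet (e k)) = x t $ k - x s $ k"
    and G: "smooth G"
    and Y0: "\<And>t. Y t [] = G (x t)"
    and Y1: "\<And>t k. Y t (bullet (e k)) = partial_deriv k G (x t)"
    and Y2: "\<And>t k l. Y t (bullet (e k) @ bullet (e l)) = partial_deriv k (partial_deriv l G) (x t)"
    and Y3: "\<And>t \<tau>. \<tau> \<noteq> [] \<Longrightarrow> (\<And>k. \<tau> \<noteq> bullet (e k)) \<Longrightarrow>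
      (\<And>k l. \<tau> \<noteq> bullet (e k) @ bullet (e l)) \<Longrightarrow> Y t \<tau> = 0"
  shows "controlled_path \<alpha> T X Y"
proof -
  have \<alpha>: "0 < \<alpha>" by (rule planar_rough_pathD(1)[OF X])
  have "hoelder_bounded T \<alpha> (\<lambda>s t. x t $ k - x s $ k)" for k
    using planar_rough_pathD(6)[OF X, of "bullet (e k)"] N
      hoelder_bounded_cong[of T "\<lambda>s t. X s t (bullet (e k))" "\<lambda>s t. x t $ k - x s $ k" \<alpha>, OF x]
    by simp
  then have xh: "hoelder_bounded T \<alpha> (\<lambda>s t. x t - x s)" by (rule hoelder_bounded_vec)
  note taylor = taylor_hoelder[OF _ xh less_imp_le[OF \<alpha>]]
  have dG: "smooth (partial_deriv k G)" "smooth (partial_deriv k (partial_deriv l G))" for k l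
    using G smooth_partial_deriv by blast+
  \<comment> \<open>Grouped by the suffix \<tau>, the sum is an expansion, written with words of X,
    of the derivative of G attached to \<tau>: to second order for the empty forest, to first order
    for one vertex, and the bare value for two.\<close>
  have expand: "(\<Sum>\<sigma>\<in>forests_upto 2. star (X s t) (forest_vec \<tau>) \<sigma> *\<^sub>R Y s \<sigma>) =
      of_bool ([] = \<tau>) *\<^sub>R (G (x s) + (\<Sum>k\<in>UNIV. X s t (bullet (e k)) *\<^sub>R partial_deriv k G (x s)) +
        (\<Sum>k\<in>UNIV. \<Sum>l\<in>UNIV. X s t (bullet (e k) @ bullet (e l)) *\<^sub>R partial_deriv k (partial_deriv l G) (x s))) +
      (\<Sum>l\<in>UNIV. of_bool (bullet (e l) = \<tau>) *\<^sub>R (partial_deriv l G (x s) +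
        (\<Sum>k\<in>UNIV. X s t (bullet (e k)) *\<^sub>R partial_deriv k (partial_deriv l G) (x s)))) +
      (\<Sum>k\<in>UNIV. \<Sum>l\<in>UNIV. of_bool (bullet (e k) @ bullet (e l) = \<tau>) *\<^sub>R partial_deriv k (partial_deriv l G) (x s))"
    if st: "s \<in> {0..T}" "t \<in> {0..T}" for s t \<tau>
  proof -
    have swap: "(\<Sum>k\<in>UNIV. \<Sum>l\<in>UNIV. (X s t (bullet (e k)) * of_bool (bullet (e l) = \<tau>)) *\<^sub>R partial_deriv k (partial_deriv l G) (x s))
      = (\<Sum>l\<in>UNIV. \<Sum>k\<in>UNIV. (of_bool (bullet (e l) = \<tau>) * X s t (bullet (e k))) *\<^sub>R partial_deriv k (partial_deriv l G) (x s))"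
      by (subst sum.swap) (simp add: mult.commute)
    have sum2: "(\<Sum>\<sigma>\<in>forests_upto 2. c \<sigma> *\<^sub>R Y s \<sigma>) = c [] *\<^sub>R Y s [] +
        (\<Sum>k\<in>UNIV. c (bullet (e k)) *\<^sub>R Y s (bullet (e k))) +
        (\<Sum>k\<in>UNIV. \<Sum>l\<in>UNIV. c (bullet (e k) @ bullet (e l)) *\<^sub>R Y s (bullet (e k) @ bullet (e l)))" for c
      by (rule sum_forests_upto_2[OF e]) (rule Y3)
    show ?thesis
      unfolding sum2 star_forest_vec Y0 Y1 Y2 planar_rough_pathD(3)[OF X st]
        scaleR_add_left sum.distrib swap
      by (simp add: scaleR_add_right scaleR_sum_right sum.distrib mult.commute)
  qed
  have "hoelder_bounded T ((3 - real (fsize \<tau>)) * \<alpha>)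
      (\<lambda>s t. Y t \<tau> - (\<Sum>\<sigma>\<in>forests_upto 2. star (X s t) (forest_vec \<tau>) \<sigma> *\<^sub>R Y s \<sigma>))"
    for \<tau>
  proof -
    \<comment> \<open>In the first three cases a Taylor sum of \<open>3 - |\<tau>|\<close> terms
      supplies the required exponent \<open>(3 - |\<tau>|) \<alpha>\<close>.\<close>
    consider (nil) "\<tau> = []" | (one) k where "\<tau> = bullet (e k)"
      | (two) k l where "\<tau> = bullet (e k) @ bullet (e l)"
      | (other) "\<tau> \<noteq> []" "\<And>k. \<tau> \<noteq> bullet (e k)" "\<And>k l. \<tau> \<noteq> bullet (e k) @ bullet (e l)"
      by blast
    then show ?thesis
    proof cases
      case nil
      have "G (x t) - (\<Sum>m<3. (1 / fact m) *\<^sub>R iterated_dir_deriv m G (x t - x s) (x s)) =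
          Y t [] - (\<Sum>\<sigma>\<in>forests_upto 2. star (X s t) (forest_vec []) \<sigma> *\<^sub>R Y s \<sigma>)"
        if st: "s \<in> {0..T}" "t \<in> {0..T}" for s t
      proof -
        have "(\<Sum>m<3. (1 / fact m) *\<^sub>R iterated_dir_deriv m G (x t - x s) (x s)) =
            G (x s) + iterated_dir_deriv (Suc 0) G (x t - x s) (x s) +
            (1 / 2) *\<^sub>R iterated_dir_deriv 2 G (x t - x s) (x s)"
          by (simp add: numeral_3_eq_3 numeral_2_eq_2)
        also have "iterated_dir_deriv 2 G (x t - x s) (x s) = 2 *\<^sub>R (\<Sum>i\<in>UNIV. \<Sum>j\<in>UNIV.
            X s t (bullet (e i) @ bullet (e j)) *\<^sub>R partial_deriv i (partial_deriv j G) (x s))"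
          by (rule iterated_dir_deriv_2[OF G])
            (simp add: rough_path_bullets(1)[OF X N st] x[OF st, symmetric])
        finally show ?thesis
          unfolding expand[OF st] Y0 by (simp add: x[OF st])
      qed
      then show ?thesis
        using taylor[OF G, of 3] nil
        by (subst hoelder_bounded_cong[symmetric]) (auto simp del: sum.lessThan_Suc)
    next
      case (one k)
      have *: "of_bool (bullet (e l) = bullet (e k)) = (of_bool (l = k) :: real)" for l
        using e by (simp add: inj_eq)
      have "partial_deriv k G (x t) - (\<Sum>m<2. (1 / fact m) *\<^sub>R iterated_dir_deriv m (partial_deriv k G) (x t - x s) (x s)) =
          Y t \<tau> - (\<Sum>\<sigma>\<in>forests_upto 2. star (X s t) (forest_vec \<tau>) \<sigma> *\<^sub>R Y s \<sigma>)"
        if st: "s \<in> {0..T}" "t \<in> {0..T}" for s t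
        unfolding one expand[OF st] Y1 *
        by (simp add: numeral_2_eq_2 x[OF st] of_bool_def if_distrib[of "\<lambda>c. c *\<^sub>R _"] cong: if_cong)
      then show ?thesis
        using taylor[OF dG(1), of 2 k] one
        by (subst hoelder_bounded_cong[symmetric]) (auto simp del: sum.lessThan_Suc)
    next
      case (two k l)
      have *: "of_bool (bullet (e k') @ bullet (e l') = bullet (e k) @ bullet (e l)) = (of_bool (k' = k) * of_bool (l' = l) :: real)" for k' l'
        using e by (simp add: inj_eq)
      have delta: "(\<Sum>k'\<in>UNIV. \<Sum>l'\<in>UNIV. (of_bool (k' = k) * of_bool (l' = l)) *\<^sub>R V k' l') = V k l"
        for V :: "'d \<Rightarrow> 'd \<Rightarrow> 'v"
      proof -
        have "(\<Sum>k'\<in>UNIV. \<Sum>l'\<in>UNIV. (of_bool (k' = k) * of_bool (l' = l)) *\<^sub>R V k' l')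
            = (\<Sum>k'\<in>UNIV. if k' = k then \<Sum>l'\<in>UNIV. if l' = l then V k' l' else 0 else 0)"
          by (intro sum.cong refl) (auto simp: of_bool_def if_distrib[of "\<lambda>c. c *\<^sub>R _"] cong: if_cong)
        then show ?thesis by simp
      qed
      have "partial_deriv k (partial_deriv l G) (x t) - (\<Sum>m<1. (1 / fact m) *\<^sub>R iterated_dir_deriv m (partial_deriv k (partial_deriv l G)) (x t - x s) (x s)) =
          Y t \<tau> - (\<Sum>\<sigma>\<in>forests_upto 2. star (X s t) (forest_vec \<tau>) \<sigma> *\<^sub>R Y s \<sigma>)"
        if st: "s \<in> {0..T}" "t \<in> {0..T}" for s t
        unfolding two expand[OF st] Y2 * delta by simp
      then show ?thesis
        using taylor[OF dG(2), of 1 k l] two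
        by (subst hoelder_bounded_cong[symmetric]) (auto simp del: sum.lessThan_Suc)
    next
      \<comment> \<open>Ladders and forests with letters outside the range of e are no suffix of a
        word in the support of Y, so the remainder is identically 0.\<close>
      case other
      have "Y t \<tau> - (\<Sum>\<sigma>\<in>forests_upto 2. star (X s t) (forest_vec \<tau>) \<sigma> *\<^sub>R Y s \<sigma>) = 0"
        if st: "s \<in> {0..T}" "t \<in> {0..T}" for s t
      proof -
        have "of_bool ([] = \<tau>) = (0::real)" "of_bool (bullet (e k) = \<tau>) = (0::real)"
          "of_bool (bullet (e k) @ bullet (e l) = \<tau>) = (0::real)" for k l
          using other by (auto simp: of_bool_def)
        then show ?thesis unfolding expand[OF st] using Y3[OF other] by simp
      qed
      then show ?thesis
        by (subst hoelder_bounded_cong[where B = "\<lambda>s t. 0"]) (auto intro: hoelder_bounded_0)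
    qed
  qed
  moreover have "Y t \<tau> = 0" if "\<tau> \<notin> forests_upto 2" for t \<tau>
    by (rule Y3) (use that in \<open>auto simp: forests_upto_def\<close>)
  ultimately show ?thesis unfolding controlled_path_def N by simp
qed

section \<open>Riemann terms of lifted integrands\<close>

lemma rough_sum_term_lift:
  fixes X :: "real \<Rightarrow> real \<Rightarrow> 'b::finite forest \<Rightarrow> real" and e :: "'d::finite \<Rightarrow> 'b"
    and G :: "real^'d \<Rightarrow> 'v::real_inner"
  assumes N: "rp_order \<alpha> = 3" and e: "inj e"
    and Y0: "\<And>t. Y t [] = G (x t)"
    and Y1: "\<And>t k. Y t (bullet (e k)) = partial_deriv k G (x t)"
    and Y2: "\<And>t k l. Y t (bullet (e k) @ bullet (e l)) = partial_deriv k (partial_deriv l G) (x t)"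
    and Y3: "\<And>t \<tau>. \<tau> \<noteq> [] \<Longrightarrow> (\<And>k. \<tau> \<noteq> bullet (e k)) \<Longrightarrow>
      (\<And>k l. \<tau> \<noteq> bullet (e k) @ bullet (e l)) \<Longrightarrow> Y t \<tau> = 0"
  shows "rough_sum_term \<alpha> X Y b u v = X u v (bullet b) *\<^sub>R G (x u) +
    (\<Sum>k\<in>UNIV. X u v (bplus b (bullet (e k))) *\<^sub>R partial_deriv k G (x u)) +
    (\<Sum>k\<in>UNIV. \<Sum>l\<in>UNIV. X u v (bplus b (bullet (e k) @ bullet (e l))) *\<^sub>R
      partial_deriv k (partial_deriv l G) (x u))"
proof -
  have "rough_sum_term \<alpha> X Y b u v = X u v (bplus b []) *\<^sub>R Y u [] +
    (\<Sum>k\<in>UNIV. X u v (bplus b (bullet (e k))) *\<^sub>R Y u (bullet (e k))) +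
    (\<Sum>k\<in>UNIV. \<Sum>l\<in>UNIV. X u v (bplus b (bullet (e k) @ bullet (e l))) *\<^sub>R Y u (bullet (e k) @ bullet (e l)))"
    unfolding rough_sum_term_def using N
    by (simp only: diff_numeral_Suc) (simp, rule sum_forests_upto_2[OF e, simplified], rule Y3, auto)
  then show ?thesis unfolding Y0 Y1 Y2 .
qed

lemma lift_fun_eq_0:
  assumes "\<tau> \<noteq> []" "\<And>k. \<tau> \<noteq> bullet k" "\<And>k l. \<tau> \<noteq> bullet k @ bullet l"
  shows "lift_fun G x t \<tau> = 0"
  using assms by (cases "(G, x, t, \<tau>)" rule: lift_fun.cases) auto

lemma extend_zero_lift:
  "extend_zero (lift_fun G x) t [] = G (x t)"
  "extend_zero (lift_fun G x) t (bullet (Inl k)) = partial_deriv k G (x t)"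
  "extend_zero (lift_fun G x) t (bullet (Inl k) @ bullet (Inl l)) = partial_deriv k (partial_deriv l G) (x t)"
  using extend_zero_embed[of "lift_fun G x" t "[]"] extend_zero_embed[of "lift_fun G x" t "bullet k"]
    extend_zero_embed[of "lift_fun G x" t "bullet k @ bullet l"]
  by (simp_all add: embed_def)

lemma extend_zero_lift_eq_0:
  assumes "\<tau> \<noteq> []" "\<And>k. \<tau> \<noteq> bullet (Inl k)" "\<And>k l. \<tau> \<noteq> bullet (Inl k) @ bullet (Inl l)"
  shows "extend_zero (lift_fun G x) t \<tau> = 0"
proof (cases "\<tau> \<in> range embed")
  case True
  then obtain \<sigma> where \<sigma>: "\<tau> = embed \<sigma>" by blast
  have "\<sigma> \<noteq> []" "\<sigma> \<noteq> bullet k" "\<sigma> \<noteq> bullet k @ bullet l" for k l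
    using assms(1) assms(2)[of k] assms(3)[of k l] by (auto simp: \<sigma> embed_def)
  then show ?thesis unfolding \<sigma> extend_zero_embed by (intro lift_fun_eq_0)
qed (simp add: extend_zero_def)

section \<open>The Ito formula\<close>

text \<open>The crossed terms of Chen's relation cancel because
  \<open>\<langle>Xh, \<bullet>\<^sub>(\<^sub>i\<^sub>j\<^sub>)\<rangle> = \<langle>X, \<bullet>\<^sub>j \<bullet>\<^sub>i - [\<bullet>\<^sub>j]\<^sub>i\<rangle>\<close>.\<close>

lemma tilde_increment_additive:
  fixes Xh :: "real \<Rightarrow> real \<Rightarrow> ('d::finite + 'd \<times> 'd) forest \<Rightarrow> real" and i j k :: 'd
  assumes Xh: "planar_rough_path \<alpha> T Xh" and N: "rp_order \<alpha> = 3"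
    and br: "\<And>s t i j. s \<in> {0..T} \<Longrightarrow> t \<in> {0..T} \<Longrightarrow> Xh s t (bullet (Inr (i, j))) =
      Xh s t (bullet (Inl j) @ bullet (Inl i)) - Xh s t (bplus (Inl i) (bullet (Inl j)))"
    and st: "s \<in> {0..T}" "u \<in> {0..T}" "t \<in> {0..T}"
  defines "I \<equiv> \<lambda>s t. Xh s t (bullet (Inl k) @ bullet (Inl j) @ bullet (Inl i))
    - Xh s t (bplus (Inl i) (bullet (Inl k) @ bullet (Inl j))) - Xh s t (bplus (Inr (i, j)) (bullet (Inl k)))"
  shows "I s t = I s u + I u t"
proof -
  have c3: "coprod (bullet a @ bullet b @ bullet c) = {#(bullet a @ bullet b @ bullet c, []),
      (bullet a @ bullet b, bullet c), (bullet a, bullet b @ bullet c), ([], bullet a @ bullet b @ bullet c)#}"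
    for a b c :: "'d + 'd \<times> 'd"
    using coprod_snoc_bullet[of "bullet a @ bullet b" c] coprod_two_bullets[of a b] by simp
  \<comment> \<open>For the letters at hand, the products with left factor \<open>k j\<close> cancel
    between word and cherry. Those with left factor k leave \<open>Xh u t\<close> on
    \<open>j i\<close> minus the ladder, which is the bracket letter in the mixed term of
    \<open>[k]_(ij)\<close>.\<close>
  have "Xh s t (bullet a @ bullet b @ bullet c) = Xh s u (bullet a @ bullet b @ bullet c) +
      Xh s u (bullet a @ bullet b) * Xh u t (bullet c) + Xh s u (bullet a) * Xh u t (bullet b @ bullet c) +
      Xh u t (bullet a @ bullet b @ bullet c)" for a b c
    using planar_rough_pathD(4)[OF Xh st, of "bullet a @ bullet b @ bullet c"] N
      planar_rough_pathD(3)[OF Xh] st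
    by (simp add: star_def c3[simplified])
  moreover have "Xh s t (bplus c (bullet a @ bullet b)) = Xh s u (bplus c (bullet a @ bullet b)) +
      Xh s u (bullet a @ bullet b) * Xh u t (bullet c) + Xh s u (bullet a) * Xh u t (bplus c (bullet b)) +
      Xh u t (bplus c (bullet a @ bullet b))" for a b c
    using planar_rough_pathD(4)[OF Xh st, of "bplus c (bullet a @ bullet b)"] N
      planar_rough_pathD(3)[OF Xh] st
    by (simp add: star_def coprod_bplus coprod_two_bullets[simplified])
  moreover have "Xh s t (bplus c (bullet a)) = Xh s u (bplus c (bullet a)) +
      Xh s u (bullet a) * Xh u t (bullet c) + Xh u t (bplus c (bullet a))" for a c
    using planar_rough_pathD(4)[OF Xh st, of "bplus c (bullet a)"] N planar_rough_pathD(3)[OF Xh] st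
    by (simp add: star_def coprod_ladder)
  ultimately show ?thesis
    using br[OF st(2,3), of i j] by (simp only: I_def) (simp add: algebra_simps)
qed

text \<open>P and Q stand for words of two and three letters, L for ladders, C for cherries, B for
  the trees \<open>[k]_(ij)\<close>. The ladders from the integrals against X cancel those in the
  bracket letter; cherries and B cancel their counterparts in the increment of \<open>Xt\<close>.
  Only symmetry of D2 and D3 aligns the indices. E collects what remains uncancelled.\<close>

lemma ito_algebra:
  fixes D1 :: "'i::finite \<Rightarrow> 'v::real_vector"
  assumes D2: "\<And>i j. D2 i j = D2 j i"
    and D3: "\<And>i j k. D3 i j k = D3 j i k" "\<And>i j k. D3 i j k = D3 i k j"
  shows "(\<Sum>i\<in>UNIV. h i *\<^sub>R D1 i + (\<Sum>k\<in>UNIV. L k i *\<^sub>R D2 k i) + (\<Sum>k\<in>UNIV. \<Sum>l\<in>UNIV. C k l i *\<^sub>R D3 k l i)) +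
    (\<Sum>i\<in>UNIV. \<Sum>j\<in>UNIV. (P i j - L j i) *\<^sub>R D2 i j + (\<Sum>k\<in>UNIV. B k i j *\<^sub>R D3 k i j) + E i j) +
    (\<Sum>i\<in>UNIV. \<Sum>j\<in>UNIV. \<Sum>k\<in>UNIV. (Q i j k - C k j i - B k i j) *\<^sub>R D3 i j k) =
    (\<Sum>i\<in>UNIV. h i *\<^sub>R D1 i) + (\<Sum>i\<in>UNIV. \<Sum>j\<in>UNIV. P i j *\<^sub>R D2 i j) +
    (\<Sum>i\<in>UNIV. \<Sum>j\<in>UNIV. \<Sum>k\<in>UNIV. Q i j k *\<^sub>R D3 i j k) + (\<Sum>i\<in>UNIV. \<Sum>j\<in>UNIV. E i j)"
proof -
  have "(\<Sum>i\<in>UNIV. \<Sum>k\<in>UNIV. L k i *\<^sub>R D2 k i) = (\<Sum>i\<in>UNIV. \<Sum>j\<in>UNIV. L j i *\<^sub>R D2 i j)"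
    by (simp add: D2)
  moreover have "(\<Sum>i\<in>UNIV. \<Sum>k\<in>UNIV. \<Sum>l\<in>UNIV. C k l i *\<^sub>R D3 k l i) =
      (\<Sum>i\<in>UNIV. \<Sum>j\<in>UNIV. \<Sum>k\<in>UNIV. C k j i *\<^sub>R D3 i j k)"
    by (rule sum.cong[OF refl], rule trans[OF sum.swap], intro sum.cong refl) (metis D3)
  moreover have "(\<Sum>i\<in>UNIV. \<Sum>j\<in>UNIV. \<Sum>k\<in>UNIV. B k i j *\<^sub>R D3 k i j) =
      (\<Sum>i\<in>UNIV. \<Sum>j\<in>UNIV. \<Sum>k\<in>UNIV. B k i j *\<^sub>R D3 i j k)"
    by (intro sum.cong refl) (metis D3)
  ultimately show ?thesis
    by (simp add: sum.distrib scaleR_diff_left sum_subtractf)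
qed

text \<open>Integrals are definite descriptions, so the identity is stated together with the
  existence of every limit, and likewise with controlledness of the lifts and existence of
  \<open>Xt\<close> for each initial value.\<close>

theorem theorem3p6:
  fixes \<alpha> T :: real
    and X :: "real \<Rightarrow> real \<Rightarrow> 'd::finite forest \<Rightarrow> real"
    and Xh :: "real \<Rightarrow> real \<Rightarrow> ('d + 'd \<times> 'd) forest \<Rightarrow> real"
    and x :: "real \<Rightarrow> real^'d"
    and xh :: "'d \<Rightarrow> 'd \<Rightarrow> real \<Rightarrow> real"
    and F :: "real^'d \<Rightarrow> real^'n::finite"
  assumes "1 / 4 < \<alpha>" and "\<alpha> \<le> 1 / 3" and "0 < T"
    and "planar_rough_path \<alpha> T X"
    and "above_path T X (\<lambda>t i. x t $ i)"
    and "bracket_extension \<alpha> T X Xh"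
    and "above_path T Xh (underlying_path x xh)"
    and "bracket_graded \<alpha> T Xh"
    and "smooth F"
  shows "(\<forall>i. controlled_path \<alpha> T X (lift_fun (partial_deriv i F) x)) \<and>
    (\<forall>i j. controlled_path \<alpha> T Xh
       (extend_zero (lift_fun (partial_deriv i (partial_deriv j F)) x))) \<and>
    (\<forall>x0 :: 'd \<Rightarrow> 'd \<Rightarrow> 'd \<Rightarrow> real. \<exists>Xt. is_tilde_path T Xh Xt \<and> (\<forall>i j k. Xt i j k 0 = x0 i j k)) \<and>
    (\<forall>Xt. is_tilde_path T Xh Xt \<longrightarrow> (\<forall>s\<in>{0..T}. \<forall>t\<in>{0..T}.
       (\<forall>i. rough_integrable \<alpha> X (lift_fun (partial_deriv i F) x) i s t) \<and>
       (\<forall>i j. rough_integrable \<alpha> Xh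
          (extend_zero (lift_fun (partial_deriv i (partial_deriv j F)) x)) (Inr (i, j)) s t) \<and>
       (\<forall>i j k. young_integrable
          (\<lambda>r. partial_deriv i (partial_deriv j (partial_deriv k F)) (x r)) (Xt i j k) s t) \<and>
       F (x t) - F (x s) =
         (\<Sum>i\<in>UNIV. rough_integral \<alpha> X (lift_fun (partial_deriv i F) x) i s t) +
         (\<Sum>i\<in>UNIV. \<Sum>j\<in>UNIV. rough_integral \<alpha> Xh
            (extend_zero (lift_fun (partial_deriv i (partial_deriv j F)) x)) (Inr (i, j)) s t) +
         (\<Sum>i\<in>UNIV. \<Sum>j\<in>UNIV. \<Sum>k\<in>UNIV. young_integral
            (\<lambda>r. partial_deriv i (partial_deriv j (partial_deriv k F)) (x r)) (Xt i j k) s t)))"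
proof -
  note X = assms(4) and F = assms(9)
  have Xh: "planar_rough_path \<alpha> T Xh"
    using assms(6) by (simp add: bracket_extension_def)
  have \<alpha>: "0 < \<alpha>" "1 < 4 * \<alpha>" using assms(1) by simp_all
  have "\<lfloor>1 / \<alpha>\<rfloor> = 3"
    using assms(1,2) \<alpha> by (intro floor_unique) (simp_all add: field_simps)
  then have N: "rp_order \<alpha> = 3" by (simp add: rp_order_def)
  have embed_eq: "Xh s t (embed \<tau>) = X s t \<tau>"
    if "s \<in> {0..T}" "t \<in> {0..T}" "fsize \<tau> \<le> 3" for s t \<tau>
    using assms(6) that by (simp add: bracket_extension_def N forests_upto_def)
  have xX: "X s t (bullet k) = x t $ k - x s $ k" if "s \<in> {0..T}" "t \<in> {0..T}" for s t k
    using assms(5) that by (simp add: above_path_def)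
  have xXh: "Xh s t (bullet (Inl k)) = x t $ k - x s $ k" if "s \<in> {0..T}" "t \<in> {0..T}" for s t k
    using assms(7) that by (simp add: above_path_def underlying_path_def)
  have bracket: "Xh s t (bullet (Inr (i, j))) = X s t (bullet j @ bullet i) - X s t (bplus i (bullet j))"
    if "s \<in> {0..T}" "t \<in> {0..T}" for s t i j
    using assms(6) that by (simp add: bracket_extension_def)
  \<comment> \<open>The bracket identity in terms of \<open>Xh\<close> alone, so that Chen's
    relation for one rough path suffices for the increments of \<open>Xt\<close>.\<close>
  have bracket_h: "Xh s t (bullet (Inr (i, j))) =
      Xh s t (bullet (Inl j) @ bullet (Inl i)) - Xh s t (bplus (Inl i) (bullet (Inl j)))"
    if "s \<in> {0..T}" "t \<in> {0..T}" for s t i j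
    using bracket[OF that, of i j] embed_eq[OF that, of "bullet j @ bullet i"]
      embed_eq[OF that, of "bplus i (bullet j)"] by (simp add: embed_def)
  have graded: "hoelder_bounded T ((real (fsize \<tau>) + 2) * \<alpha>) (\<lambda>s t. Xh s t (bplus (Inr (i, j)) (embed \<tau>)))"
    if "fsize \<tau> \<le> 2" for i j \<tau>
    using assms(8) that unfolding bracket_graded_def N by (auto simp: forests_upto_def)
  have dF: "smooth (partial_deriv i F)" "smooth (partial_deriv i (partial_deriv j F))"
    "smooth (partial_deriv i (partial_deriv j (partial_deriv k F)))"
    "smooth (partial_deriv i (partial_deriv j (partial_deriv k (partial_deriv l F))))" for i j k l
    using F smooth_partial_deriv by blast+
  have xh: "hoelder_bounded T \<alpha> (\<lambda>s t. x t - x s)"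
  proof (rule hoelder_bounded_vec)
    show "hoelder_bounded T \<alpha> (\<lambda>s t. x t $ k - x s $ k)" for k
      using planar_rough_pathD(6)[OF X, of "bullet k"] N
        hoelder_bounded_cong[of T "\<lambda>s t. X s t (bullet k)" "\<lambda>s t. x t $ k - x s $ k" \<alpha>, OF xX]
      by simp
  qed

  have ctrl1: "controlled_path \<alpha> T X (lift_fun (partial_deriv i F) x)" for i
    by (rule controlled_path_lift[where e = "\<lambda>k. k", OF X N _ xX dF(1)])
      (simp_all add: lift_fun_eq_0[simplified])
  have ctrl2: "controlled_path \<alpha> T Xh (extend_zero (lift_fun (partial_deriv i (partial_deriv j F)) x))" for i j
    by (rule controlled_path_lift[where e = Inl, OF Xh N _ xXh dF(2)])
      (simp_all add: extend_zero_lift[simplified] extend_zero_lift_eq_0[simplified])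

  define I where "I i j k s t = Xh s t (bullet (Inl k) @ bullet (Inl j) @ bullet (Inl i))
    - Xh s t (bplus (Inl i) (bullet (Inl k) @ bullet (Inl j)))
    - Xh s t (bplus (Inr (i, j)) (bullet (Inl k)))" for i j k s t
  have I_add: "I i j k s t = I i j k s u + I i j k u t"
    if "s \<in> {0..T}" "u \<in> {0..T}" "t \<in> {0..T}" for i j k s t u
    unfolding I_def by (rule tilde_increment_additive[OF Xh N bracket_h that])
  have I_0: "I i j k 0 0 = 0" for i j k
    using I_add[of 0 0 0] assms(3) by simp
  have ex_tilde: "\<exists>Xt. is_tilde_path T Xh Xt \<and> (\<forall>i j k. Xt i j k 0 = x0 i j k)"
    for x0 :: "'d \<Rightarrow> 'd \<Rightarrow> 'd \<Rightarrow> real"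
  proof (intro exI conjI allI)
    \<comment> \<open>An additive two-parameter function consists of the increments of its values
      measured from time 0.\<close>
    show "is_tilde_path T Xh (\<lambda>i j k t. x0 i j k + I i j k 0 t)"
      unfolding is_tilde_path_def I_def[symmetric]
    proof (intro ballI allI)
      fix s t i j k assume "s \<in> {0..T}" "t \<in> {0..T}"
      then have "I i j k 0 t = I i j k 0 s + I i j k s t" using assms(3) by (intro I_add) auto
      then show "x0 i j k + I i j k 0 t - (x0 i j k + I i j k 0 s) = I i j k s t" by simp
    qed
    show "x0 i j k + I i j k 0 0 = x0 i j k" for i j k by (simp add: I_0)
  qed

  have I_hoelder: "hoelder_bounded T (3 * \<alpha>) (I i j k)" for i j k
  proof -
    have 1: "hoelder_bounded T (3 * \<alpha>) (\<lambda>s t. Xh s t (bullet (Inl k) @ bullet (Inl j) @ bullet (Inl i)))"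
      using planar_rough_pathD(6)[OF Xh, of "bullet (Inl k) @ bullet (Inl j) @ bullet (Inl i)"] N by simp
    have 2: "hoelder_bounded T (3 * \<alpha>) (\<lambda>s t. Xh s t (bplus (Inl i) (bullet (Inl k) @ bullet (Inl j))))"
      using planar_rough_pathD(6)[OF Xh, of "bplus (Inl i) (bullet (Inl k) @ bullet (Inl j))"] N by simp
    \<comment> \<open>This tree has two vertices, so the rough path bound alone would give only
      \<open>2 \<alpha>\<close>; the grading of the bracket letter raises it.\<close>
    have 3: "hoelder_bounded T (3 * \<alpha>) (\<lambda>s t. Xh s t (bplus (Inr (i, j)) (bullet (Inl k))))"
      using graded[of "bullet k" i j] by (simp add: embed_def)
    show ?thesis unfolding I_def[abs_def]
      by (intro hoelder_bounded_diff 1 2 3)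
  qed

  \<comment> \<open>The only part of the germs outside the Taylor polynomial. Its trees have three
    vertices; by the grading they are of order \<open>4 \<alpha>\<close> instead of
    \<open>3 \<alpha>\<close>.\<close>
  define E where "E i j u v = (\<Sum>k\<in>UNIV. \<Sum>l\<in>UNIV. Xh u v (bplus (Inr (i, j)) (bullet (Inl k) @ bullet (Inl l))) *\<^sub>R
      partial_deriv k (partial_deriv l (partial_deriv i (partial_deriv j F))) (x u))" for i j u v
  have E_hoelder: "hoelder_bounded T (4 * \<alpha>) (E i j)" for i j
    unfolding E_def[abs_def]
  proof (intro hoelder_bounded_sum)
    fix k l
    have 1: "hoelder_bounded T (4 * \<alpha>) (\<lambda>s t. Xh s t (bplus (Inr (i, j)) (bullet (Inl k) @ bullet (Inl l))))"
      using graded[of "bullet k @ bullet l" i j] by (simp add: embed_def)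
    have 2: "hoelder_bounded T 0 (\<lambda>s t. partial_deriv k (partial_deriv l (partial_deriv i (partial_deriv j F))) (x s))"
      by (rule hoelder_bounded_path[OF dF(4) xh less_imp_le[OF \<alpha>(1)]])
    show "hoelder_bounded T (4 * \<alpha>) (\<lambda>u v. Xh u v (bplus (Inr (i, j)) (bullet (Inl k) @ bullet (Inl l))) *\<^sub>R
      partial_deriv k (partial_deriv l (partial_deriv i (partial_deriv j F))) (x u))"
      using hoelder_bounded_scaleR[OF 1 2] by simp
  qed

  have ito: "(\<forall>i. rough_integrable \<alpha> X (lift_fun (partial_deriv i F) x) i s t) \<and>
       (\<forall>i j. rough_integrable \<alpha> Xh
          (extend_zero (lift_fun (partial_deriv i (partial_deriv j F)) x)) (Inr (i, j)) s t) \<and>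
       (\<forall>i j k. young_integrable
          (\<lambda>r. partial_deriv i (partial_deriv j (partial_deriv k F)) (x r)) (Xt i j k) s t) \<and>
       F (x t) - F (x s) =
         (\<Sum>i\<in>UNIV. rough_integral \<alpha> X (lift_fun (partial_deriv i F) x) i s t) +
         (\<Sum>i\<in>UNIV. \<Sum>j\<in>UNIV. rough_integral \<alpha> Xh
            (extend_zero (lift_fun (partial_deriv i (partial_deriv j F)) x)) (Inr (i, j)) s t) +
         (\<Sum>i\<in>UNIV. \<Sum>j\<in>UNIV. \<Sum>k\<in>UNIV. young_integral
            (\<lambda>r. partial_deriv i (partial_deriv j (partial_deriv k F)) (x r)) (Xt i j k) s t)"
    if Xt: "is_tilde_path T Xh Xt" and st: "s \<in> {0..T}" "t \<in> {0..T}" for Xt s t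
  proof -
    have XtI: "Xt i j k v - Xt i j k u = I i j k u v" if "u \<in> {0..T}" "v \<in> {0..T}" for i j k u v
      using Xt that by (simp add: is_tilde_path_def I_def)
    let ?Y1 = "\<lambda>i. lift_fun (partial_deriv i F) x"
    let ?Y2 = "\<lambda>i j. extend_zero (lift_fun (partial_deriv i (partial_deriv j F)) x)"
    let ?G = "\<lambda>i j k r. partial_deriv i (partial_deriv j (partial_deriv k F)) (x r)"
    have int1: "rough_integrable \<alpha> X (?Y1 i) i s t" for i
      by (rule rough_integrable_controlled[OF X ctrl1 st])
    have int2: "rough_integrable \<alpha> Xh (?Y2 i j) (Inr (i, j)) s t" for i j
      by (rule rough_integrable_controlled[OF Xh ctrl2 st])
    have int3: "young_integrable (?G i j k) (Xt i j k) s t" for i j k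
    proof (rule young_integrable_hoelder)
      show "hoelder_bounded T \<alpha> (\<lambda>s t. ?G i j k t - ?G i j k s)"
        using taylor_hoelder[OF dF(3) xh less_imp_le[OF \<alpha>(1)], of 1 i j k] by simp
      show "hoelder_bounded T (3 * \<alpha>) (\<lambda>s t. Xt i j k t - Xt i j k s)"
        using I_hoelder[of i j k] hoelder_bounded_cong[of T "\<lambda>s t. Xt i j k t - Xt i j k s" "I i j k", OF XtI]
        by simp
    qed (use \<alpha> st in auto)
    define \<Xi> where "\<Xi> u v = (\<Sum>i\<in>UNIV. rough_sum_term \<alpha> X (?Y1 i) i u v) +
      (\<Sum>i\<in>UNIV. \<Sum>j\<in>UNIV. rough_sum_term \<alpha> Xh (?Y2 i j) (Inr (i, j)) u v) +
      (\<Sum>i\<in>UNIV. \<Sum>j\<in>UNIV. \<Sum>k\<in>UNIV. young_sum_term (?G i j k) (Xt i j k) u v)" for u v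
    \<comment> \<open>The total germ plus F(x u) is exactly the third-order Taylor polynomial plus
      the sum of the E terms.\<close>
    have local: "F (x v) - F (x u) - \<Xi> u v =
        (F (x v) - (\<Sum>m<4. (1 / fact m) *\<^sub>R iterated_dir_deriv m F (x v - x u) (x u)))
        - (\<Sum>i\<in>UNIV. \<Sum>j\<in>UNIV. E i j u v)" if uv: "u \<in> {0..T}" "v \<in> {0..T}" for u v
    proof -
      have r1: "rough_sum_term \<alpha> X (?Y1 i) i u v = X u v (bullet i) *\<^sub>R partial_deriv i F (x u) +
          (\<Sum>k\<in>UNIV. X u v (bplus i (bullet k)) *\<^sub>R partial_deriv k (partial_deriv i F) (x u)) +
          (\<Sum>k\<in>UNIV. \<Sum>l\<in>UNIV. X u v (bplus i (bullet k @ bullet l)) *\<^sub>R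
            partial_deriv k (partial_deriv l (partial_deriv i F)) (x u))" for i
        by (rule rough_sum_term_lift[where e = "\<lambda>k. k", OF N])
          (simp_all add: lift_fun_eq_0[simplified])
      have r2: "rough_sum_term \<alpha> Xh (?Y2 i j) (Inr (i, j)) u v =
          (X u v (bullet j @ bullet i) - X u v (bplus i (bullet j))) *\<^sub>R partial_deriv i (partial_deriv j F) (x u) +
          (\<Sum>k\<in>UNIV. Xh u v (bplus (Inr (i, j)) (bullet (Inl k))) *\<^sub>R ?G k i j u) + E i j u v" for i j
        unfolding E_def bracket[OF uv, symmetric]
        by (rule rough_sum_term_lift[OF N, where e = Inl])
          (simp_all add: extend_zero_lift[simplified] extend_zero_lift_eq_0[simplified])
      have r3: "young_sum_term (?G i j k) (Xt i j k) u v =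
          (X u v (bullet k @ bullet j @ bullet i) - X u v (bplus i (bullet k @ bullet j))
            - Xh u v (bplus (Inr (i, j)) (bullet (Inl k)))) *\<^sub>R ?G i j k u" for i j k
        using embed_eq[OF uv, of "bullet k @ bullet j @ bullet i"] embed_eq[OF uv, of "bplus i (bullet k @ bullet j)"]
        by (simp add: young_sum_term_def XtI[OF uv] I_def embed_def)
      have "\<Xi> u v = (\<Sum>i\<in>UNIV. X u v (bullet i) *\<^sub>R partial_deriv i F (x u)) +
          (\<Sum>i\<in>UNIV. \<Sum>j\<in>UNIV. X u v (bullet j @ bullet i) *\<^sub>R partial_deriv i (partial_deriv j F) (x u)) +
          (\<Sum>i\<in>UNIV. \<Sum>j\<in>UNIV. \<Sum>k\<in>UNIV. X u v (bullet k @ bullet j @ bullet i) *\<^sub>R ?G i j k u) +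
          (\<Sum>i\<in>UNIV. \<Sum>j\<in>UNIV. E i j u v)"
        unfolding \<Xi>_def r1 r2 r3
      proof (rule ito_algebra)
        show "partial_deriv i (partial_deriv j F) (x u) = partial_deriv j (partial_deriv i F) (x u)" for i j
          by (rule partial_deriv_commute[OF F])
        show "?G i j k u = ?G j i k u" for i j k by (rule partial_deriv_commute[OF dF(1)])
        have "partial_deriv j (partial_deriv k F) = partial_deriv k (partial_deriv j F)" for j k
          using partial_deriv_commute[OF F] by (rule ext)
        then show "?G i j k u = ?G i k j u" for i j k by metis
      qed
      moreover have "(\<Sum>m<4. (1 / fact m) *\<^sub>R iterated_dir_deriv m F (x v - x u) (x u)) =
          F (x u) + iterated_dir_deriv (Suc 0) F (x v - x u) (x u) +
          (1 / 2) *\<^sub>R iterated_dir_deriv 2 F (x v - x u) (x u) +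
          (1 / 6) *\<^sub>R iterated_dir_deriv 3 F (x v - x u) (x u)"
        by (simp add: eval_nat_numeral fact_numeral del: iterated_dir_deriv.simps(2))
      moreover have "iterated_dir_deriv (Suc 0) F (x v - x u) (x u) =
          (\<Sum>i\<in>UNIV. X u v (bullet i) *\<^sub>R partial_deriv i F (x u))"
        by (simp add: xX[OF uv])
      moreover have "iterated_dir_deriv 2 F (x v - x u) (x u) =
          2 *\<^sub>R (\<Sum>i\<in>UNIV. \<Sum>j\<in>UNIV. X u v (bullet j @ bullet i) *\<^sub>R partial_deriv i (partial_deriv j F) (x u))"
        by (rule iterated_dir_deriv_2[OF F])
          (simp add: rough_path_bullets(1)[OF X N uv] xX[OF uv, symmetric])
      moreover have "iterated_dir_deriv 3 F (x v - x u) (x u) = 6 *\<^sub>R (\<Sum>i\<in>UNIV. \<Sum>j\<in>UNIV. \<Sum>k\<in>UNIV.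
          X u v (bullet k @ bullet j @ bullet i) *\<^sub>R ?G i j k u)"
      \<comment> \<open>Here \<open>P i j k\<close> is the word \<open>k j i\<close>; as all six
        orderings occur, reading words backwards only permutes the summands of the shuffle
        relation.\<close>
      proof (rule iterated_dir_deriv_3[OF F])
        show "(x v - x u) $ i * (x v - x u) $ j * (x v - x u) $ k =
            X u v (bullet k @ bullet j @ bullet i) + X u v (bullet j @ bullet k @ bullet i) +
            X u v (bullet k @ bullet i @ bullet j) + X u v (bullet i @ bullet k @ bullet j) +
            X u v (bullet j @ bullet i @ bullet k) + X u v (bullet i @ bullet j @ bullet k)" for i j k
          using rough_path_bullets(2)[OF X N uv, of i j k]
          unfolding xX[OF uv] vector_minus_component by linarith
      qed
      ultimately show ?thesis by simp
    qed
    have "hoelder_bounded T (4 * \<alpha>) (\<lambda>u v. F (x v) - F (x u) - \<Xi> u v)"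
    proof (subst hoelder_bounded_cong[OF local], assumption, assumption)
      show "hoelder_bounded T (4 * \<alpha>) (\<lambda>u v.
          (F (x v) - (\<Sum>m<4. (1 / fact m) *\<^sub>R iterated_dir_deriv m F (x v - x u) (x u)))
          - (\<Sum>i\<in>UNIV. \<Sum>j\<in>UNIV. E i j u v))"
        by (rule hoelder_bounded_diff[OF _ hoelder_bounded_sum[OF hoelder_bounded_sum[OF E_hoelder]]])
          (use taylor_hoelder[OF F xh less_imp_le[OF \<alpha>(1)], of 4] in simp)
    qed
    moreover have "has_mesh_limit \<Xi> s t
        ((\<Sum>i\<in>UNIV. rough_integral \<alpha> X (?Y1 i) i s t) +
         (\<Sum>i\<in>UNIV. \<Sum>j\<in>UNIV. rough_integral \<alpha> Xh (?Y2 i j) (Inr (i, j)) s t) +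
         (\<Sum>i\<in>UNIV. \<Sum>j\<in>UNIV. \<Sum>k\<in>UNIV. young_integral (?G i j k) (Xt i j k) s t))"
      unfolding \<Xi>_def[abs_def]
      by (intro has_mesh_limit_add has_mesh_limit_sum rough_integral_has_mesh_limit
          young_integral_has_mesh_limit int1 int2 int3)
    ultimately have "F (x t) - F (x s) = (\<Sum>i\<in>UNIV. rough_integral \<alpha> X (?Y1 i) i s t) +
         (\<Sum>i\<in>UNIV. \<Sum>j\<in>UNIV. rough_integral \<alpha> Xh (?Y2 i j) (Inr (i, j)) s t) +
         (\<Sum>i\<in>UNIV. \<Sum>j\<in>UNIV. \<Sum>k\<in>UNIV. young_integral (?G i j k) (Xt i j k) s t)"
      by (intro mesh_limit_eq_increment[where f = "\<lambda>r. F (x r)", OF \<alpha>(2) st])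
    with int1 int2 int3 show ?thesis by blast
  qed
  show ?thesis using ctrl1 ctrl2 ex_tilde ito by blast
qed

end
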